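(* Let $G$ be an étale groupoid and $A\subseteq G^{(0)}$ a compact open subset. If $A$ is $(G^{op},2,1)$-paradoxical, then there exist elements $f,g\in C_c(G)$ with $E(f),E(g)\ge 0$ such that $f^**f=g^**g=1_A$ and $f*f^*+g*g^*\le 1_A$. In this case $1_A$ is a properly infinite projection in $C_r^*(G)$.
   Context: Groupoids are locally compact Hausdorff with continuous product and inversion; $G^{(0)}$ is the unit space, $r(g)=gg^{-1}$, $d(g)=g^{-1}g$. A bisection is a subset $S\subseteq G$ such that $r|_S$ and $d|_S$ are homeomorphisms onto open subsets of $G$; $G^{op}$ is the set of all open bisections. $G$ is étale if it has a basis of open bisections. $C_c(G)$ carries the convolution $(f_1*f_2)(g)=\sum_{h: r(h)=r(g)}f_1(h)f_2(h^{-1}g)$ and involution $f^*(g)=\overline{f(g^{-1})}$; $C_r^*(G)$ is the reduced groupoid $C^*$-algebra, $C_0(G^{(0)})\subseteq C_r^*(G)$ via extension by zero, and $E:C_r^*(G)\to C_0(G^{(0)})$ is the conditional expectation extending the restriction map $C_c(G)\to C_c(G^{(0)})$. $1_A$ is the characteristic function of $A$. For a family $\mathbb{E}$ of bisections and integers $k>l>0$, a non-empty subset $A\subseteq G^{(0)}$ is $(\mathbb{E},k,l)$-paradoxical if for each $1\le i\le k$ there are $n_i\in\mathbb{N}$, bisections $V_{i,1},\dots,V_{i,n_i}\in\mathbb{E}$ and $m_{i,1},\dots,m_{i,n_i}\in\{1,\dots,l\}$ such that $\bigcup_{j=1}^{n_i}d(V_{i,j})=A$ for all $i$, and the sets $r(V_{i,j})\times\{m_{i,j}\}\subseteq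 A\times\{1,\dots,l\}$ are pairwise disjoint. A non-zero projection $p$ in a $C^*$-algebra $B$ is properly infinite if there are partial isometries $x,y\in B$ with $x^*x=y^*y=p$ and $xx^*+yy^*\le p$. *)

theory Defs
  imports "HOL-Analysis.Analysis"
begin

section \<open>Topological and etale groupoids\<close>

text \<open>
  The elements of a groupoid are all elements of its underlying type; only the product is partial,
  and the values of \<open>gmult\<close> off \<open>composable\<close> are irrelevant.
\<close>

record 'g groupoid =
  composable :: "('g \<times> 'g) set"
  gmult :: "'g \<Rightarrow> 'g \<Rightarrow> 'g"
  ginv :: "'g \<Rightarrow> 'g"

definition grng :: "'g groupoid \<Rightarrow> 'g \<Rightarrow> 'g" where
  "grng G g = gmult G g (ginv G g)"

definition gdom :: "'g groupoid \<Rightarrow> 'g \<Rightarrow> 'g" where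
  "gdom G g = gmult G (ginv G g) g"

definition units :: "'g groupoid \<Rightarrow> 'g set" where
  "units G = range (grng G)"

definition algebraic_groupoid :: "'g groupoid \<Rightarrow> bool" where
  "algebraic_groupoid G \<longleftrightarrow>
     (\<forall>g. ginv G (ginv G g) = g) \<and>
     (\<forall>g h k. (g, h) \<in> composable G \<longrightarrow> (h, k) \<in> composable G \<longrightarrow>
        (gmult G g h, k) \<in> composable G \<and> (g, gmult G h k) \<in> composable G \<and>
        gmult G (gmult G g h) k = gmult G g (gmult G h k)) \<and>
     (\<forall>g. (g, ginv G g) \<in> composable G \<and> (ginv G g, g) \<in> composable G) \<and>
     (\<forall>g h. (g, h) \<in> composable G \<longrightarrow>
        gmult G (ginv G g) (gmult G g h) = h \<and> gmult G (gmult G g h) (ginv G h) = g)"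

text \<open>The Hausdorff property is the sort \<open>t2_space\<close>.\<close>

definition topological_groupoid :: "'g::t2_space groupoid \<Rightarrow> bool" where
  "topological_groupoid G \<longleftrightarrow>
     algebraic_groupoid G \<and>
     locally_compact_space (euclidean :: 'g topology) \<and>
     continuous_on (composable G) (\<lambda>(g, h). gmult G g h) \<and>
     continuous_on UNIV (ginv G)"

definition bisection :: "'g::t2_space groupoid \<Rightarrow> 'g set \<Rightarrow> bool" where
  "bisection G S \<longleftrightarrow>
     open (grng G ` S) \<and> (\<exists>s. homeomorphism S (grng G ` S) (grng G) s) \<and>
     open (gdom G ` S) \<and> (\<exists>s. homeomorphism S (gdom G ` S) (gdom G) s)"

definition open_bisections :: "'g::t2_space groupoid \<Rightarrow> 'g set set" where
  "open_bisections G = {S. open S \<and> bisection G S}"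

definition etale_groupoid :: "'g::t2_space groupoid \<Rightarrow> bool" where
  "etale_groupoid G \<longleftrightarrow> topological_groupoid G \<and> topological_basis (open_bisections G)"

definition paradoxical ::
  "'g::t2_space groupoid \<Rightarrow> 'g set set \<Rightarrow> nat \<Rightarrow> nat \<Rightarrow> 'g set \<Rightarrow> bool" where
  "paradoxical G \<E> k l A \<longleftrightarrow>
     0 < l \<and> l < k \<and> A \<noteq> {} \<and> A \<subseteq> units G \<and>
     (\<exists>(n :: nat \<Rightarrow> nat) (V :: nat \<Rightarrow> nat \<Rightarrow> 'g set) (m :: nat \<Rightarrow> nat \<Rightarrow> nat).
        (\<forall>i\<in>{1..k}. \<forall>j\<in>{1..n i}. V i j \<in> \<E> \<and> m i j \<in> {1..l}) \<and>
        (\<forall>i\<in>{1..k}. (\<Union>j\<in>{1..n i}. gdom G ` V i j) = A) \<and>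
        (\<forall>i\<in>{1..k}. \<forall>j\<in>{1..n i}. (grng G ` V i j) \<times> {m i j} \<subseteq> A \<times> {1..l}) \<and>
        disjoint_family_on (\<lambda>(i, j). (grng G ` V i j) \<times> {m i j}) (SIGMA i:{1..k}. {1..n i}))"

section \<open>The convolution algebra\<close>

definition Cc :: "('g::topological_space \<Rightarrow> complex) set" where
  "Cc = {f. continuous_on UNIV f \<and> compact (closure {g. f g \<noteq> 0})}"

text \<open>
  If \<open>G\<close> is etale and \<open>f1\<close> is in \<open>Cc\<close>, then only finitely many terms of the sum are nonzero.
\<close>

definition conv :: "'g groupoid \<Rightarrow> ('g \<Rightarrow> complex) \<Rightarrow> ('g \<Rightarrow> complex) \<Rightarrow> 'g \<Rightarrow> complex" where
  "conv G f1 f2 g = (\<Sum>\<^sub>\<infinity>h\<in>{h. grng G h = grng G g}. f1 h * f2 (gmult G (ginv G h) g))"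

definition invol :: "'g groupoid \<Rightarrow> ('g \<Rightarrow> complex) \<Rightarrow> 'g \<Rightarrow> complex" where
  "invol G f g = cnj (f (ginv G g))"

section \<open>Bounded operators on square-summable functions\<close>

definition ell2 :: "('g \<Rightarrow> complex) set" where
  "ell2 = {\<xi>. (\<lambda>x. (cmod (\<xi> x))\<^sup>2) summable_on UNIV}"

definition ell2_inner :: "('g \<Rightarrow> complex) \<Rightarrow> ('g \<Rightarrow> complex) \<Rightarrow> complex" where
  "ell2_inner \<xi> \<eta> = (\<Sum>\<^sub>\<infinity>x. \<xi> x * cnj (\<eta> x))"

definition ell2_norm :: "('g \<Rightarrow> complex) \<Rightarrow> real" where
  "ell2_norm \<xi> = sqrt (\<Sum>\<^sub>\<infinity>x. (cmod (\<xi> x))\<^sup>2)"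

type_synonym 'g operator = "('g \<Rightarrow> complex) \<Rightarrow> ('g \<Rightarrow> complex)"

text \<open>
  Operators are normalised to vanish off \<open>ell2\<close>, so that equality of bounded operators is equality
  of functions.
\<close>

definition bounded_ops :: "'g operator set" where
  "bounded_ops = {T.
     (\<forall>\<xi>\<in>ell2. T \<xi> \<in> ell2) \<and>
     (\<forall>\<xi>\<in>ell2. \<forall>\<eta>\<in>ell2. T (\<lambda>x. \<xi> x + \<eta> x) = (\<lambda>x. T \<xi> x + T \<eta> x)) \<and>
     (\<forall>c. \<forall>\<xi>\<in>ell2. T (\<lambda>x. c * \<xi> x) = (\<lambda>x. c * T \<xi> x)) \<and>
     (\<exists>C. \<forall>\<xi>\<in>ell2. ell2_norm (T \<xi>) \<le> C * ell2_norm \<xi>) \<and>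
     (\<forall>\<xi>. \<xi> \<notin> ell2 \<longrightarrow> T \<xi> = (\<lambda>x. 0))}"

definition op_norm :: "'g operator \<Rightarrow> real" where
  "op_norm T = (SUP \<xi>\<in>{\<xi>\<in>ell2. ell2_norm \<xi> \<le> 1}. ell2_norm (T \<xi>))"

definition op_adjoint :: "'g operator \<Rightarrow> 'g operator" where
  "op_adjoint T = (THE S. S \<in> bounded_ops \<and>
     (\<forall>\<xi>\<in>ell2. \<forall>\<eta>\<in>ell2. ell2_inner (T \<xi>) \<eta> = ell2_inner \<xi> (S \<eta>)))"

section \<open>Proper infiniteness in a C*-algebra\<close>

record 'b cstar_structure =
  ccarrier :: "'b set"
  czero :: 'b
  cadd :: "'b \<Rightarrow> 'b \<Rightarrow> 'b"
  cscale :: "complex \<Rightarrow> 'b \<Rightarrow> 'b"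
  cmult :: "'b \<Rightarrow> 'b \<Rightarrow> 'b"
  cstar :: "'b \<Rightarrow> 'b"
  cnorm :: "'b \<Rightarrow> real"

text \<open>\<open>a \<le> b\<close> means that \<open>b - a\<close> is positive, that is, of the form \<open>z* z\<close>.\<close>

definition cstar_le :: "'b cstar_structure \<Rightarrow> 'b \<Rightarrow> 'b \<Rightarrow> bool" where
  "cstar_le B a b \<longleftrightarrow> a \<in> ccarrier B \<and> b \<in> ccarrier B \<and>
     (\<exists>z\<in>ccarrier B. b = cadd B a (cmult B (cstar B z) z))"

definition projection :: "'b cstar_structure \<Rightarrow> 'b \<Rightarrow> bool" where
  "projection B p \<longleftrightarrow> p \<in> ccarrier B \<and> cmult B p p = p \<and> cstar B p = p"

definition partial_isometry :: "'b cstar_structure \<Rightarrow> 'b \<Rightarrow> bool" where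
  "partial_isometry B x \<longleftrightarrow> x \<in> ccarrier B \<and> projection B (cmult B (cstar B x) x)"

definition properly_infinite :: "'b cstar_structure \<Rightarrow> 'b \<Rightarrow> bool" where
  "properly_infinite B p \<longleftrightarrow> projection B p \<and> p \<noteq> czero B \<and>
     (\<exists>x y. partial_isometry B x \<and> partial_isometry B y \<and>
        cmult B (cstar B x) x = p \<and> cmult B (cstar B y) y = p \<and>
        cstar_le B (cadd B (cmult B x (cstar B x)) (cmult B y (cstar B y))) p)"

section \<open>The reduced groupoid C*-algebra\<close>

text \<open>
  The Hilbert space of square-summable functions on \<open>G\<close> is the orthogonal sum over the units \<open>u\<close>
  of those on the fibres \<open>{g. gdom G g = u}\<close>. Left convolution preserves the fibres, so
  \<open>reg_rep G\<close> is the direct sum of the regular representations of \<open>Cc\<close> at all units, and the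
  operator norm of \<open>reg_rep G f\<close> is the reduced norm of \<open>f\<close>.
\<close>

definition reg_rep :: "'g groupoid \<Rightarrow> ('g \<Rightarrow> complex) \<Rightarrow> 'g operator" where
  "reg_rep G f = (\<lambda>\<xi>. if \<xi> \<in> ell2 then conv G f \<xi> else (\<lambda>x. 0))"

text \<open>The operator-norm closure of the image of \<open>Cc\<close>.\<close>

definition reduced_carrier :: "'g::t2_space groupoid \<Rightarrow> 'g operator set" where
  "reduced_carrier G = {T \<in> bounded_ops. \<forall>\<epsilon>>0. \<exists>f\<in>Cc.
     op_norm (\<lambda>\<xi> x. T \<xi> x - reg_rep G f \<xi> x) < \<epsilon>}"

definition reduced_Cstar :: "'g::t2_space groupoid \<Rightarrow> 'g operator cstar_structure" where
  "reduced_Cstar G = \<lparr>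
     ccarrier = reduced_carrier G,
     czero = (\<lambda>\<xi> x. 0),
     cadd = (\<lambda>S T \<xi> x. S \<xi> x + T \<xi> x),
     cscale = (\<lambda>c T \<xi> x. c * T \<xi> x),
     cmult = (\<lambda>S T. S \<circ> T),
     cstar = op_adjoint,
     cnorm = op_norm\<rparr>"

text \<open>
  The conditional expectation onto \<open>C\<^sub>0\<close> of the unit space, with values extended by zero to \<open>G\<close>.
  The two lemmas below show that it extends the restriction map and is contractive for the supremum
  norm, hence is the unique continuous extension of the restriction map.
\<close>

definition cond_exp :: "'g groupoid \<Rightarrow> 'g operator \<Rightarrow> 'g \<Rightarrow> complex" where
  "cond_exp G T u = (if u \<in> units G then T (indicator {u}) u else 0)"

lemma indicator_singleton_ell2:
  "(indicator {u} :: 'g \<Rightarrow> complex) \<in> ell2" "ell2_norm (indicator {u} :: 'g \<Rightarrow> complex) = 1"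
proof -
  have eq: "(\<lambda>x. (cmod (indicator {u} x))\<^sup>2) = (indicator {u} :: 'g \<Rightarrow> real)"
    by (auto simp: indicator_def)
  have s: "((indicator {u} :: 'g \<Rightarrow> real) has_sum 1) UNIV"
  proof -
    have "((indicator {u} :: 'g \<Rightarrow> real) has_sum 1) {u}" by (rule has_sum_finiteI) auto
    then show ?thesis by (rule has_sum_cong_neutral[THEN iffD1, rotated -1]) auto
  qed
  show "(indicator {u} :: 'g \<Rightarrow> complex) \<in> ell2"
    using s by (auto simp: ell2_def eq summable_on_def)
  show "ell2_norm (indicator {u} :: 'g \<Rightarrow> complex) = 1"
    using infsumI[OF s] by (simp add: ell2_norm_def eq)
qed

lemma cond_exp_reg_rep:
  assumes "algebraic_groupoid G" and "u \<in> units G"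
  shows "cond_exp G (reg_rep G f) u = f u"
proof -
  have c: "(g, ginv G g) \<in> composable G" "(ginv G g, g) \<in> composable G"
    and ii: "ginv G (ginv G g) = g" for g
    using assms(1) unfolding algebraic_groupoid_def by blast+
  have canc: "gmult G (ginv G g) (gmult G g h) = h" "gmult G (gmult G g h) (ginv G h) = g"
    if "(g, h) \<in> composable G" for g h
    using assms(1) that unfolding algebraic_groupoid_def by blast+
  have assoc: "(gmult G g h, k) \<in> composable G" "(g, gmult G h k) \<in> composable G"
    "gmult G (gmult G g h) k = gmult G g (gmult G h k)"
    if "(g, h) \<in> composable G" "(h, k) \<in> composable G" for g h k
    using assms(1) that unfolding algebraic_groupoid_def by blast+
  obtain v where v: "u = grng G v" using assms(2) by (auto simp: units_def)
  have uv: "(u, v) \<in> composable G" "gmult G u v = v"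
    using assoc[OF c(1)[of v] c(2)[of v]] canc(2)[OF c(1)[of v]]
    by (auto simp: v grng_def ii)
  have ru: "grng G u = u"
  proof -
    have "gmult G (gmult G u v) (ginv G v) = u" using canc(2)[OF uv(1)] .
    have "(ginv G u, u) \<in> composable G" by (rule c)
    have a: "gmult G (ginv G u) v = v" using canc(1)[OF uv(1)] uv(2) by simp
    have b: "(ginv G u, v) \<in> composable G"
      using assoc(2)[OF c(2)[of u] uv(1)] uv(2) by simp
    have "ginv G u = u"
      using canc(2)[OF b] canc(2)[OF uv(1)] a uv(2) by simp
    moreover have "gmult G u u = u"
      using assoc(3)[OF uv(1) c(1)[of v]] uv(2) by (simp add: v grng_def)
    ultimately show ?thesis by (simp add: grng_def)
  qed
  have key: "gmult G (ginv G h) u = u \<longleftrightarrow> h = u" if h: "grng G h = u" for h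
  proof -
    have r: "gmult G (ginv G h) u = ginv G h"
      using canc(1)[OF c(1)[of h]] h by (simp add: grng_def)
    have "ginv G u = u"
      using r ru canc(1)[OF c(1)[of u]] canc(2)[OF uv(1)] uv
      by (metis assoc(2) c(2) canc(1) canc(2))
    then show ?thesis using r ii by metis
  qed
  have "conv G f (indicator {u}) u = infsum f {u}"
    unfolding conv_def
  proof (rule infsum_cong_neutral)
    fix h assume "h \<in> {h. grng G h = grng G u} - {u}"
    then show "f h * indicator {u} (gmult G (ginv G h) u) = 0" using key[of h] ru by auto
  qed (use key[of u] ru in \<open>auto\<close>)
  then show ?thesis
    using assms(2) by (simp add: cond_exp_def reg_rep_def indicator_singleton_ell2)
qed

lemma norm_cond_exp_le:
  assumes "T \<in> bounded_ops" and "u \<in> units G"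
  shows "cmod (cond_exp G T u) \<le> op_norm T"
proof -
  define d where "d = (indicator {u} :: 'a \<Rightarrow> complex)"
  have d: "d \<in> ell2" "ell2_norm d = 1"
    unfolding d_def by (rule indicator_singleton_ell2)+
  have Td: "T d \<in> ell2" using assms(1) d by (auto simp: bounded_ops_def)
  obtain C where C: "\<And>\<xi>. \<xi> \<in> ell2 \<Longrightarrow> ell2_norm (T \<xi>) \<le> C * ell2_norm \<xi>"
    using assms(1) unfolding bounded_ops_def by blast
  have nn: "0 \<le> ell2_norm \<xi>" for \<xi> :: "'a \<Rightarrow> complex"
    by (simp add: ell2_norm_def infsum_nonneg)
  have "(\<Sum>x\<in>{u}. (cmod (T d x))\<^sup>2) \<le> (\<Sum>\<^sub>\<infinity>x. (cmod (T d x))\<^sup>2)"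
    using Td by (intro finite_sum_le_infsum) (auto simp: ell2_def)
  then have "cmod (T d u) \<le> ell2_norm (T d)"
    unfolding ell2_norm_def by (intro real_le_rsqrt) simp
  also have "\<dots> \<le> op_norm T"
    unfolding op_norm_def
  proof (rule cSUP_upper)
    show "bdd_above ((\<lambda>\<xi>. ell2_norm (T \<xi>)) ` {\<xi> \<in> ell2. ell2_norm \<xi> \<le> 1})"
    proof (rule bdd_aboveI2[of _ _ "\<bar>C\<bar>"])
      fix \<xi> :: "'a \<Rightarrow> complex" assume x: "\<xi> \<in> {\<xi> \<in> ell2. ell2_norm \<xi> \<le> 1}"
      then have "ell2_norm (T \<xi>) \<le> C * ell2_norm \<xi>" using C by auto
      also have "\<dots> \<le> \<bar>C\<bar> * 1" using x nn[of \<xi>] by (intro mult_mono) auto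
      finally show "ell2_norm (T \<xi>) \<le> \<bar>C\<bar>" by simp
    qed
  qed (use d in auto)
  finally show ?thesis using assms(2) by (simp add: cond_exp_def d_def)
qed

end

theory Submission
  imports Defs
begin

text \<open>
  Write \<open>V\<^sub>i\<^sub>,\<^sub>j\<close> for the open bisections of a \<open>(2, 1)\<close>-paradoxical decomposition of \<open>A\<close>. For fixed
  \<open>i\<close> their sources form an open cover of the compact set \<open>A\<close>; choose a partition of unity \<open>h\<^sub>i\<^sub>,\<^sub>j\<close>
  subordinate to it and let \<open>f\<^sub>i\<close> be \<open>sqrt (h\<^sub>i\<^sub>,\<^sub>j \<circ> d)\<close> on \<open>V\<^sub>i\<^sub>,\<^sub>j\<close> and zero elsewhere. A term of
  \<open>(f\<^sub>i* * f\<^sub>i')(g)\<close> involves two elements \<open>k\<close> and \<open>k g\<close> with the same range, and there is only one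
  level, so disjointness of the sets \<open>r(V\<^sub>i\<^sub>,\<^sub>j)\<close> forces both into the same bisection and
  then \<open>k g = k\<close>. Hence \<open>f\<^sub>1* * f\<^sub>2 = 0\<close>, and \<open>f\<^sub>i* * f\<^sub>i\<close> lives on the units, where it is the sum of
  the \<open>h\<^sub>i\<^sub>,\<^sub>j\<close>, that is, \<open>1\<^sub>A\<close> (\<open>section_of_bisections\<close>). The partition of unity replaces the
  characteristic functions that would do if \<open>G\<close> had a basis of compact open bisections.

  The rest is algebra: \<open>f\<^sub>1\<close> and \<open>f\<^sub>2\<close> are isometries with orthogonal ranges below the projection
  \<open>1\<^sub>A\<close>, so \<open>z = 1\<^sub>A - f\<^sub>1 * f\<^sub>1* - f\<^sub>2 * f\<^sub>2*\<close> is a projection, and \<open>z* * z = z\<close> exhibits the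
  required inequality (\<open>orthogonal_isometries_properly_infinite\<close>).

  To carry out this algebra among operators, the regular representation has to be a
  \<open>*\<close>-homomorphism from compactly supported continuous functions into bounded operators. On
  square-summable functions on \<open>G\<close>, convolution by \<open>f\<close> is the matrix with entry \<open>f(g k\<inverse>)\<close> at
  \<open>(g, k)\<close> whenever \<open>d(g) = d(k)\<close>. If \<open>f\<close> is compactly supported, finitely many open bisections cover
  its support, so the rows and columns of this matrix have boundedly many nonzero entries.
  Such matrices are bounded operators, with the expected adjoints and products.
  That the convolution of two compactly supported continuous functions is again continuous is
  reduced, by a partition of unity, to a first factor supported in a single open bisection, for
  which every convolution sum has at most one term.
\<close>

section \<open>Sparse matrices acting on square-summable functions\<close>

definition sparse_matrix :: "nat \<Rightarrow> real \<Rightarrow> ('g \<Rightarrow> 'g \<Rightarrow> complex) \<Rightarrow> bool" where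
  "sparse_matrix N C M \<longleftrightarrow>
     (\<forall>g. finite {k. M g k \<noteq> 0} \<and> card {k. M g k \<noteq> 0} \<le> N) \<and>
     (\<forall>k. finite {g. M g k \<noteq> 0} \<and> card {g. M g k \<noteq> 0} \<le> N) \<and>
     (\<forall>g k. cmod (M g k) \<le> C)"

text \<open>
  Rows are always finitely supported where this is used, so the infinite sum never takes the
  default value of a divergent sum.
\<close>

definition mat_apply :: "('g \<Rightarrow> 'g \<Rightarrow> complex) \<Rightarrow> ('g \<Rightarrow> complex) \<Rightarrow> 'g \<Rightarrow> complex" where
  "mat_apply M \<xi> g = (\<Sum>\<^sub>\<infinity>k. M g k * \<xi> k)"

lemma sparse_matrixD:
  assumes "sparse_matrix N C M"
  shows "finite {k. M g k \<noteq> 0}" "card {k. M g k \<noteq> 0} \<le> N"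
    "finite {g. M g k \<noteq> 0}" "card {g. M g k \<noteq> 0} \<le> N" "cmod (M g k) \<le> C" "0 \<le> C"
proof -
  show "cmod (M g k) \<le> C" using assms by (simp add: sparse_matrix_def)
  then show "0 \<le> C" using norm_ge_zero order_trans by blast
qed (use assms in \<open>auto simp: sparse_matrix_def\<close>)

lemma sparse_matrix_adjoint:
  "sparse_matrix N C M \<Longrightarrow> sparse_matrix N C (\<lambda>g k. cnj (M k g))"
  by (simp add: sparse_matrix_def)

lemma mat_apply_eq_sum:
  assumes "finite F" "\<And>k. k \<notin> F \<Longrightarrow> M g k * \<xi> k = 0"
  shows "mat_apply M \<xi> g = (\<Sum>k\<in>F. M g k * \<xi> k)"
proof -
  have "mat_apply M \<xi> g = infsum (\<lambda>k. M g k * \<xi> k) F"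
    unfolding mat_apply_def by (rule infsum_cong_neutral) (use assms in auto)
  then show ?thesis using assms(1) by simp
qed

lemma mat_apply_add:
  assumes "finite {k. M g k \<noteq> 0}"
  shows "mat_apply M (\<lambda>x. \<xi> x + \<eta> x) g = mat_apply M \<xi> g + mat_apply M \<eta> g"
  using assms
  by (subst (1 2 3) mat_apply_eq_sum[where F = "{k. M g k \<noteq> 0}"])
     (auto simp: distrib_left sum.distrib)

lemma mat_apply_diff:
  assumes "finite {k. M g k \<noteq> 0}"
  shows "mat_apply M (\<lambda>x. \<xi> x - \<eta> x) g = mat_apply M \<xi> g - mat_apply M \<eta> g"
  using assms
  by (subst (1 2 3) mat_apply_eq_sum[where F = "{k. M g k \<noteq> 0}"])
     (auto simp: right_diff_distrib sum_subtractf)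

lemma mat_apply_scale:
  assumes "finite {k. M g k \<noteq> 0}"
  shows "mat_apply M (\<lambda>x. c * \<xi> x) g = c * mat_apply M \<xi> g"
  using assms
  by (subst (1 2) mat_apply_eq_sum[where F = "{k. M g k \<noteq> 0}"])
     (auto simp: sum_distrib_left mult.left_commute)

lemma mat_apply_add_left:
  assumes "finite {k. M g k \<noteq> 0}" "finite {k. M' g k \<noteq> 0}"
  shows "mat_apply (\<lambda>g k. M g k + M' g k) \<xi> g = mat_apply M \<xi> g + mat_apply M' \<xi> g"
  using assms
  by (subst (1 2 3) mat_apply_eq_sum[where F = "{k. M g k \<noteq> 0} \<union> {k. M' g k \<noteq> 0}"])
     (auto simp: distrib_right sum.distrib)

text \<open>
  Finitely supported rows make every sum finite, so the composition formula holds for arbitrary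
  vectors, square-summable or not. This is what yields associativity of convolution with an
  arbitrary third factor.
\<close>

lemma mat_apply_mat_apply:
  assumes "\<And>g. finite {k. M g k \<noteq> 0}" "\<And>g. finite {k. M' g k \<noteq> 0}"
  shows "mat_apply M (mat_apply M' \<xi>) = mat_apply (\<lambda>g k. mat_apply M (\<lambda>l. M' l k) g) \<xi>"
proof
  fix g
  define F where "F = {k. M g k \<noteq> 0}"
  define F' where "F' = (\<Union>l\<in>F. {k. M' l k \<noteq> 0})"
  have F: "finite F" "finite F'" using assms by (auto simp: F_def F'_def)
  have row: "mat_apply M \<eta> g = (\<Sum>l\<in>F. M g l * \<eta> l)" for \<eta>
    using F(1) by (rule mat_apply_eq_sum) (simp add: F_def)
  have row': "mat_apply M' \<xi> l = (\<Sum>k\<in>F'. M' l k * \<xi> k)" if "l \<in> F" for l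
    using F(2) by (rule mat_apply_eq_sum) (use that in \<open>auto simp: F'_def\<close>)
  have "mat_apply M (mat_apply M' \<xi>) g = (\<Sum>l\<in>F. \<Sum>k\<in>F'. M g l * M' l k * \<xi> k)"
    unfolding row by (intro sum.cong refl) (simp add: row' sum_distrib_left mult.assoc)
  also have "\<dots> = (\<Sum>k\<in>F'. mat_apply M (\<lambda>l. M' l k) g * \<xi> k)"
    unfolding row by (subst sum.swap) (simp add: sum_distrib_right)
  also have "\<dots> = mat_apply (\<lambda>g k. mat_apply M (\<lambda>l. M' l k) g) \<xi> g"
  proof (rule mat_apply_eq_sum[symmetric, OF F(2)])
    fix k assume "k \<notin> F'"
    then have "mat_apply M (\<lambda>l. M' l k) g = 0" unfolding row by (auto simp: F'_def)
    then show "mat_apply M (\<lambda>l. M' l k) g * \<xi> k = 0" by simp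
  qed
  finally show "mat_apply M (mat_apply M' \<xi>) g = mat_apply (\<lambda>g k. mat_apply M (\<lambda>l. M' l k) g) \<xi> g" .
qed

text \<open>
  In the double sum each \<open>\<phi> k\<close> is counted once per nonzero entry of column \<open>k\<close>, hence at most
  \<open>N\<close> times. All convergence questions about sparse matrices reduce to this count.
\<close>

lemma sparse_matrix_weights:
  assumes M: "sparse_matrix N C M" and \<phi>: "\<phi> summable_on UNIV" "\<And>k. 0 \<le> (\<phi> k :: real)"
  shows "(\<lambda>(g, k). of_bool (M g k \<noteq> 0) * \<phi> k) summable_on UNIV \<times> UNIV"
    and "(\<Sum>\<^sub>\<infinity>g. \<Sum>\<^sub>\<infinity>k. of_bool (M g k \<noteq> 0) * \<phi> k) \<le> real N * (\<Sum>\<^sub>\<infinity>k. \<phi> k)"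
proof -
  have col: "((\<lambda>g. of_bool (M g k \<noteq> 0) * \<phi> k) has_sum real (card {g. M g k \<noteq> 0}) * \<phi> k) UNIV" for k
  proof -
    have "((\<lambda>g. \<phi> k) has_sum (\<Sum>g\<in>{g. M g k \<noteq> 0}. \<phi> k)) {g. M g k \<noteq> 0}"
      by (rule has_sum_finite) (rule sparse_matrixD[OF M])
    moreover have "((\<lambda>g. \<phi> k) has_sum s) {g. M g k \<noteq> 0} \<longleftrightarrow>
        ((\<lambda>g. of_bool (M g k \<noteq> 0) * \<phi> k) has_sum s) UNIV" for s
      by (rule has_sum_cong_neutral) auto
    ultimately show ?thesis by simp
  qed
  have N: "(\<lambda>k. real N * \<phi> k) summable_on UNIV" using \<phi>(1) by (rule summable_on_cmult_right)
  have le: "real (card {g. M g k \<noteq> 0}) * \<phi> k \<le> real N * \<phi> k" for k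
    using sparse_matrixD(4)[OF M] \<phi>(2) by (intro mult_right_mono) auto
  have cs: "(\<lambda>k. real (card {g. M g k \<noteq> 0}) * \<phi> k) summable_on UNIV"
    by (rule summable_on_comparison_test[OF N]) (use le \<phi>(2) in auto)
  have "(\<lambda>(k, g). of_bool (M g k \<noteq> 0) * \<phi> k) summable_on UNIV \<times> UNIV"
    by (rule summable_on_SigmaI[OF _ cs]) (use col \<phi>(2) in auto)
  then show s: "(\<lambda>(g, k). of_bool (M g k \<noteq> 0) * \<phi> k) summable_on UNIV \<times> UNIV"
    by (subst summable_on_swap) (simp add: case_prod_unfold)
  have "(\<Sum>\<^sub>\<infinity>g. \<Sum>\<^sub>\<infinity>k. of_bool (M g k \<noteq> 0) * \<phi> k) = (\<Sum>\<^sub>\<infinity>k. \<Sum>\<^sub>\<infinity>g. of_bool (M g k \<noteq> 0) * \<phi> k)"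
    using s by (rule infsum_swap_banach)
  also have "\<dots> = (\<Sum>\<^sub>\<infinity>k. real (card {g. M g k \<noteq> 0}) * \<phi> k)"
    using infsumI[OF col] by simp
  also have "\<dots> \<le> (\<Sum>\<^sub>\<infinity>k. real N * \<phi> k)" using cs N le by (rule infsum_mono)
  also have "\<dots> = real N * (\<Sum>\<^sub>\<infinity>k. \<phi> k)" by (rule infsum_cmult_right')
  finally show "(\<Sum>\<^sub>\<infinity>g. \<Sum>\<^sub>\<infinity>k. of_bool (M g k \<noteq> 0) * \<phi> k) \<le> real N * (\<Sum>\<^sub>\<infinity>k. \<phi> k)" .
qed

text \<open>
  The Cauchy-Schwarz inequality in row \<open>g\<close> bounds the square of its entry by
  \<open>C\<^sup>2 N\<close> times the sum of \<open>\<bar>\<xi> k\<bar>\<^sup>2\<close> over the support of that row; summing over the rows costs another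
  factor \<open>N\<close>.
\<close>

lemma mat_apply_ell2:
  assumes M: "sparse_matrix N C M" and \<xi>: "\<xi> \<in> ell2"
  shows "mat_apply M \<xi> \<in> ell2" and "ell2_norm (mat_apply M \<xi>) \<le> real N * C * ell2_norm \<xi>"
proof -
  define \<phi> where "\<phi> k = (cmod (\<xi> k))\<^sup>2" for k
  have \<phi>: "\<phi> summable_on UNIV" "\<And>k. 0 \<le> \<phi> k" using \<xi> unfolding \<phi>_def[abs_def] ell2_def by auto
  define D where "D = C\<^sup>2 * real N"
  define w where "w g = D * (\<Sum>\<^sub>\<infinity>k. of_bool (M g k \<noteq> 0) * \<phi> k)" for g
  note W = sparse_matrix_weights[OF M \<phi>]
  have ws: "w summable_on UNIV"
    unfolding w_def using summable_on_Sigma_banach[OF W(1)] by (intro summable_on_cmult_right) auto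
  have ptw: "(cmod (mat_apply M \<xi> g))\<^sup>2 \<le> w g" for g
  proof -
    let ?F = "{k. M g k \<noteq> 0}"
    have F: "finite ?F" by (rule sparse_matrixD[OF M])
    have e: "mat_apply M \<xi> g = (\<Sum>k\<in>?F. M g k * \<xi> k)" using F by (rule mat_apply_eq_sum) auto
    have "cmod (mat_apply M \<xi> g) \<le> (\<Sum>k\<in>?F. C * cmod (\<xi> k))"
      unfolding e using sparse_matrixD(5)[OF M]
      by (intro sum_norm_le) (simp add: norm_mult mult_right_mono)
    then have "(cmod (mat_apply M \<xi> g))\<^sup>2 \<le> (\<Sum>k\<in>?F. C * cmod (\<xi> k))\<^sup>2"
      by (intro power_mono) auto
    also have "\<dots> = C\<^sup>2 * (\<Sum>k\<in>?F. cmod (\<xi> k))\<^sup>2"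
      by (simp add: sum_distrib_left[symmetric] power_mult_distrib)
    also have "\<dots> \<le> C\<^sup>2 * (real N * (\<Sum>k\<in>?F. \<phi> k))"
    proof (intro mult_left_mono)
      have "(\<Sum>k\<in>?F. cmod (\<xi> k))\<^sup>2 \<le> (\<Sum>k\<in>?F. \<phi> k) * real (card ?F)"
        unfolding \<phi>_def by (rule sum_squared_le_sum_of_squares)
      also have "\<dots> \<le> (\<Sum>k\<in>?F. \<phi> k) * real N"
        using sparse_matrixD(2)[OF M] \<phi>(2) by (intro mult_left_mono sum_nonneg) auto
      finally show "(\<Sum>k\<in>?F. cmod (\<xi> k))\<^sup>2 \<le> real N * (\<Sum>k\<in>?F. \<phi> k)" by (simp add: mult.commute)
    qed auto
    also have "(\<Sum>k\<in>?F. \<phi> k) = (\<Sum>\<^sub>\<infinity>k\<in>?F. \<phi> k)" using F by simp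
    also have "\<dots> = (\<Sum>\<^sub>\<infinity>k. of_bool (M g k \<noteq> 0) * \<phi> k)" by (rule infsum_cong_neutral) auto
    finally show ?thesis by (simp add: w_def D_def)
  qed
  have s: "(\<lambda>g. (cmod (mat_apply M \<xi> g))\<^sup>2) summable_on UNIV"
    by (rule summable_on_comparison_test[OF ws]) (use ptw in auto)
  then show "mat_apply M \<xi> \<in> ell2" by (simp add: ell2_def)
  have "(\<Sum>\<^sub>\<infinity>g. (cmod (mat_apply M \<xi> g))\<^sup>2) \<le> (\<Sum>\<^sub>\<infinity>g. w g)" using s ws ptw by (rule infsum_mono)
  also have "\<dots> = D * (\<Sum>\<^sub>\<infinity>g. \<Sum>\<^sub>\<infinity>k. of_bool (M g k \<noteq> 0) * \<phi> k)"
    unfolding w_def by (rule infsum_cmult_right')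
  also have "\<dots> \<le> D * (real N * (\<Sum>\<^sub>\<infinity>k. \<phi> k))"
    using W(2) by (intro mult_left_mono) (auto simp: D_def)
  also have "\<dots> = (real N * C)\<^sup>2 * (\<Sum>\<^sub>\<infinity>k. \<phi> k)" by (simp add: D_def power2_eq_square)
  finally have "ell2_norm (mat_apply M \<xi>) \<le> sqrt ((real N * C)\<^sup>2 * (\<Sum>\<^sub>\<infinity>k. \<phi> k))"
    unfolding ell2_norm_def by (rule real_sqrt_le_mono)
  also have "\<dots> = real N * C * ell2_norm \<xi>"
    using sparse_matrixD(6)[OF M] by (simp add: real_sqrt_mult ell2_norm_def \<phi>_def)
  finally show "ell2_norm (mat_apply M \<xi>) \<le> real N * C * ell2_norm \<xi>" .
qed

text \<open>
  Fubini. The terms are dominated by \<open>\<bar>\<xi> k\<bar>\<^sup>2 + \<bar>\<eta> g\<bar>\<^sup>2\<close> on the nonzero entries, and the two parts are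
  summable by counting along the columns and along the rows.
\<close>

lemma mat_apply_inner:
  assumes M: "sparse_matrix N C M" and \<xi>: "\<xi> \<in> ell2" and \<eta>: "\<eta> \<in> ell2"
  shows "ell2_inner (mat_apply M \<xi>) \<eta> = ell2_inner \<xi> (mat_apply (\<lambda>g k. cnj (M k g)) \<eta>)"
proof -
  define \<Phi> where "\<Phi> g k = M g k * \<xi> k * cnj (\<eta> g)" for g k
  let ?a = "\<lambda>(g, k). of_bool (M g k \<noteq> 0) * (cmod (\<xi> k))\<^sup>2"
  let ?b = "\<lambda>(g, k). of_bool (M g k \<noteq> 0) * (cmod (\<eta> g))\<^sup>2"
  have a: "?a summable_on UNIV \<times> UNIV"
    using sparse_matrix_weights(1)[OF M, of "\<lambda>k. (cmod (\<xi> k))\<^sup>2"] \<xi> by (simp add: ell2_def)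
  have "(\<lambda>(k, g). of_bool (cnj (M g k) \<noteq> 0) * (cmod (\<eta> g))\<^sup>2) summable_on UNIV \<times> UNIV"
    using sparse_matrix_weights(1)[OF sparse_matrix_adjoint[OF M], of "\<lambda>k. (cmod (\<eta> k))\<^sup>2"] \<eta>
    by (simp add: ell2_def)
  then have b: "?b summable_on UNIV \<times> UNIV"
    by (subst summable_on_swap) (simp add: case_prod_unfold)
  have bound: "norm (\<Phi> g k) \<le> C * (?a (g, k) + ?b (g, k))" for g k
  proof (cases "M g k = 0")
    case False
    have "2 * (cmod (\<xi> k) * cmod (\<eta> g)) \<le> (cmod (\<xi> k))\<^sup>2 + (cmod (\<eta> g))\<^sup>2"
      using sum_squares_bound[of "cmod (\<xi> k)" "cmod (\<eta> g)"] by simp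
    then have "cmod (\<xi> k) * cmod (\<eta> g) \<le> (cmod (\<xi> k))\<^sup>2 + (cmod (\<eta> g))\<^sup>2"
      using zero_le_power2[of "cmod (\<xi> k)"] zero_le_power2[of "cmod (\<eta> g)"]
      by (smt (verit, best) norm_ge_zero mult_nonneg_nonneg)
    then have "cmod (M g k) * (cmod (\<xi> k) * cmod (\<eta> g)) \<le> C * ((cmod (\<xi> k))\<^sup>2 + (cmod (\<eta> g))\<^sup>2)"
      using sparse_matrixD(5,6)[OF M] by (intro mult_mono) auto
    then show ?thesis using False by (simp add: \<Phi>_def norm_mult mult.assoc)
  qed (simp add: \<Phi>_def)
  have "(\<lambda>p. norm (case p of (g, k) \<Rightarrow> \<Phi> g k)) summable_on UNIV \<times> UNIV"
    by (rule summable_on_comparison_test[OF summable_on_cmult_right[OF summable_on_add[OF a b]]])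
       (use bound in auto)
  then have s: "(\<lambda>(g, k). \<Phi> g k) summable_on UNIV \<times> UNIV" by (rule abs_summable_summable)
  have "ell2_inner (mat_apply M \<xi>) \<eta> = (\<Sum>\<^sub>\<infinity>g. \<Sum>\<^sub>\<infinity>k. \<Phi> g k)"
    unfolding ell2_inner_def mat_apply_def \<Phi>_def by (simp add: infsum_cmult_left')
  also have "\<dots> = (\<Sum>\<^sub>\<infinity>k. \<Sum>\<^sub>\<infinity>g. \<Phi> g k)" using s by (rule infsum_swap_banach)
  also have "\<dots> = (\<Sum>\<^sub>\<infinity>k. \<xi> k * cnj (\<Sum>\<^sub>\<infinity>g. cnj (M g k) * \<eta> g))"
    by (simp add: \<Phi>_def infsum_cmult_right'[symmetric] infsum_cnj[symmetric] mult_ac)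
  finally show ?thesis by (simp add: ell2_inner_def mat_apply_def)
qed

lemma ell2_add:
  assumes "\<xi> \<in> ell2" "\<eta> \<in> ell2"
  shows "(\<lambda>x. \<xi> x + \<eta> x) \<in> ell2"
proof -
  have s: "(\<lambda>x. 2 * ((cmod (\<xi> x))\<^sup>2 + (cmod (\<eta> x))\<^sup>2)) summable_on UNIV"
    using assms unfolding ell2_def by (intro summable_on_cmult_right summable_on_add) auto
  have "(cmod (\<xi> x + \<eta> x))\<^sup>2 \<le> 2 * ((cmod (\<xi> x))\<^sup>2 + (cmod (\<eta> x))\<^sup>2)" for x
  proof -
    have "(cmod (\<xi> x + \<eta> x))\<^sup>2 \<le> (cmod (\<xi> x) + cmod (\<eta> x))\<^sup>2"
      by (intro power_mono norm_triangle_ineq) auto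
    then show ?thesis
      using sum_squares_bound[of "cmod (\<xi> x)" "cmod (\<eta> x)"] by (simp add: power2_sum)
  qed
  then show ?thesis unfolding ell2_def using summable_on_comparison_test[OF s] by auto
qed

lemma ell2_scale: "\<xi> \<in> ell2 \<Longrightarrow> (\<lambda>x. c * \<xi> x) \<in> ell2"
  unfolding ell2_def by (auto simp: norm_mult power_mult_distrib intro: summable_on_cmult_right)

lemma ell2_inner_delta: "ell2_inner (indicator {u}) \<eta> = cnj (\<eta> u)"
proof -
  have "ell2_inner (indicator {u}) \<eta> = (\<Sum>\<^sub>\<infinity>x\<in>{u}. cnj (\<eta> x))"
    unfolding ell2_inner_def by (rule infsum_cong_neutral) auto
  then show ?thesis by simp
qed

text \<open>
  Uniqueness of the adjoint: testing against point masses determines \<open>S \<eta>\<close> pointwise for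
  square-summable \<open>\<eta>\<close>, and bounded operators vanish on all other functions.
\<close>

lemma op_adjointI:
  assumes "S \<in> bounded_ops"
    and "\<And>\<xi> \<eta>. \<xi> \<in> ell2 \<Longrightarrow> \<eta> \<in> ell2 \<Longrightarrow> ell2_inner (T \<xi>) \<eta> = ell2_inner \<xi> (S \<eta>)"
  shows "op_adjoint T = S"
  unfolding op_adjoint_def
proof (rule the_equality)
  fix S' assume S': "S' \<in> bounded_ops \<and>
    (\<forall>\<xi>\<in>ell2. \<forall>\<eta>\<in>ell2. ell2_inner (T \<xi>) \<eta> = ell2_inner \<xi> (S' \<eta>))"
  show "S' = S"
  proof
    fix \<eta> :: "'a \<Rightarrow> complex"
    show "S' \<eta> = S \<eta>"
    proof (cases "\<eta> \<in> ell2")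
      case True
      show ?thesis
      proof
        fix u
        have "ell2_inner (indicator {u}) (S' \<eta>) = ell2_inner (indicator {u}) (S \<eta>)"
          using S' assms(2) True indicator_singleton_ell2(1)[of u] by metis
        then show "S' \<eta> u = S \<eta> u" by (simp add: ell2_inner_delta)
      qed
    next
      case False
      then show ?thesis using S' assms(1) by (simp add: bounded_ops_def)
    qed
  qed
qed (use assms in auto)

section \<open>Convolution in an algebraic groupoid\<close>

locale groupoid_algebra =
  fixes G :: "'g groupoid"
  assumes algebraic: "algebraic_groupoid G"
begin

abbreviation mult :: "'g \<Rightarrow> 'g \<Rightarrow> 'g" (infixl "\<cdot>" 70) where "g \<cdot> h \<equiv> gmult G g h"
abbreviation inv where "inv \<equiv> ginv G"
abbreviation rng where "rng \<equiv> grng G"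
abbreviation dom where "dom \<equiv> gdom G"

lemma inv_inv [simp]: "inv (inv g) = g"
  using algebraic unfolding algebraic_groupoid_def by blast

lemma rng_inv [simp]: "rng (inv g) = dom g" and dom_inv [simp]: "dom (inv g) = rng g"
  by (simp_all add: grng_def gdom_def)

lemma composable_inv: "(g, inv g) \<in> composable G" "(inv g, g) \<in> composable G"
  using algebraic unfolding algebraic_groupoid_def by blast+

lemma composable_assoc:
  assumes "(g, h) \<in> composable G" "(h, k) \<in> composable G"
  shows "(g \<cdot> h, k) \<in> composable G" "(g, h \<cdot> k) \<in> composable G" "g \<cdot> h \<cdot> k = g \<cdot> (h \<cdot> k)"
  using algebraic assms unfolding algebraic_groupoid_def by blast+

lemma composable_cancel:
  assumes "(g, h) \<in> composable G"
  shows "inv g \<cdot> (g \<cdot> h) = h" "g \<cdot> h \<cdot> inv h = g"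
  using algebraic assms unfolding algebraic_groupoid_def by blast+

lemma composableD:
  assumes "(g, h) \<in> composable G"
  shows "dom g = rng h"
proof -
  have "dom g \<cdot> h = h" "(dom g, h) \<in> composable G"
    using composable_assoc[OF composable_inv(2) assms] composable_cancel(1)[OF assms]
    by (simp_all add: gdom_def)
  then show ?thesis using composable_cancel(2) by (fastforce simp: grng_def)
qed

lemma composable_units: "(rng g, g) \<in> composable G" "(g, dom g) \<in> composable G"
  using composable_assoc[OF composable_inv(1) composable_inv(2)[of g]]
  by (auto simp: grng_def gdom_def)

lemma mult_units [simp]: "rng g \<cdot> g = g" "g \<cdot> dom g = g"
  using composable_assoc(3)[OF composable_inv(1) composable_inv(2)[of g]]
    composable_cancel(2)[OF composable_inv(1)[of g]]
  by (simp_all add: grng_def gdom_def)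

text \<open>
  If \<open>(g, h)\<close> is composable, then associativity gives \<open>dom g \<cdot> h = h\<close>, and cancelling \<open>h\<close> gives
  \<open>dom g = rng h\<close>. Conversely, the composable pairs \<open>(g, dom g)\<close> and \<open>(rng h, h)\<close> share the unit
  \<open>dom g = rng h\<close>, so \<open>g \<cdot> dom g = g\<close> is composable with \<open>h\<close>.
\<close>

lemma composable_iff: "(g, h) \<in> composable G \<longleftrightarrow> dom g = rng h"
proof
  assume e: "dom g = rng h"
  have "(g \<cdot> dom g, h) \<in> composable G"
    using composable_assoc(1)[of g "dom g" h] composable_units e by metis
  then show "(g, h) \<in> composable G" by simp
qed (rule composableD)

lemma unit_rng_dom [simp]:
  "rng (rng g) = rng g" "dom (rng g) = rng g" "rng (dom g) = dom g" "dom (dom g) = dom g"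
proof -
  show a: "dom (rng g) = rng g" for g using composableD[OF composable_units(1)] by simp
  show b: "rng (dom g) = dom g" for g using composableD[OF composable_units(2)] by simp
  show "rng (rng g) = rng g" "dom (dom g) = dom g" using a[of "inv g"] b[of "inv g"] by simp_all
qed

lemma rng_mult [simp]: "dom g = rng h \<Longrightarrow> rng (g \<cdot> h) = rng g"
  and dom_mult [simp]: "dom g = rng h \<Longrightarrow> dom (g \<cdot> h) = dom h"
  using composable_assoc(2)[of "rng g" g h] composable_assoc(1)[of g h "dom h"]
  by (simp_all add: composable_iff)

lemma mult_assoc: "dom g = rng h \<Longrightarrow> dom h = rng k \<Longrightarrow> g \<cdot> h \<cdot> k = g \<cdot> (h \<cdot> k)"
  by (rule composable_assoc) (simp_all add: composable_iff)

lemma inv_mult_cancel [simp]: "dom g = rng h \<Longrightarrow> inv g \<cdot> (g \<cdot> h) = h"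
  and mult_inv_cancel [simp]: "dom g = rng h \<Longrightarrow> g \<cdot> h \<cdot> inv h = g"
  by (simp_all add: composable_cancel composable_iff)

lemma mult_inv_mult_cancel [simp]: "rng g = rng h \<Longrightarrow> g \<cdot> (inv g \<cdot> h) = h"
  and mult_inv_cancel' [simp]: "dom g = dom h \<Longrightarrow> g \<cdot> inv h \<cdot> h = g"
  using inv_mult_cancel[of "inv g" h] mult_inv_cancel[of g "inv h"] by simp_all

lemma rng_in_units [simp]: "rng g \<in> units G" and dom_in_units [simp]: "dom g \<in> units G"
  using rangeI[of rng g] rangeI[of rng "inv g"] by (simp_all add: units_def)

lemma unit_simps [simp]:
  assumes "u \<in> units G"
  shows "rng u = u" "dom u = u" "inv u = u"
proof -
  obtain g where u: "u = rng g" using assms by (auto simp: units_def)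
  then show r: "rng u = u" "dom u = u" by simp_all
  have "inv u = inv u \<cdot> dom (inv u)" by (simp only: mult_units)
  also have "\<dots> = dom u" unfolding dom_inv r(1) by (simp only: gdom_def)
  also have "\<dots> = u" using r by simp
  finally show "inv u = u" .
qed

lemma inv_mult:
  assumes "dom g = rng h"
  shows "inv (g \<cdot> h) = inv h \<cdot> inv g"
proof -
  have "g \<cdot> h \<cdot> (inv h \<cdot> inv g) = g \<cdot> h \<cdot> inv h \<cdot> inv g"
    using assms by (intro mult_assoc[symmetric]) auto
  also have "\<dots> = rng (g \<cdot> h)" using assms by (simp add: grng_def[of G g])
  finally have "inv h \<cdot> inv g = inv (g \<cdot> h) \<cdot> rng (g \<cdot> h)"
    using inv_mult_cancel[of "g \<cdot> h" "inv h \<cdot> inv g"] assms by simp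
  also have "\<dots> = inv (g \<cdot> h)" using mult_units(2)[of "inv (g \<cdot> h)"] by simp
  finally show ?thesis by simp
qed

text \<open>
  Substituting \<open>k = h\<inverse> g\<close> in the convolution sum turns convolution by \<open>f\<close> into this matrix. In this form,
  involution becomes the conjugate transpose and convolution the matrix product.
\<close>

definition conv_matrix :: "('g \<Rightarrow> complex) \<Rightarrow> 'g \<Rightarrow> 'g \<Rightarrow> complex" where
  "conv_matrix f g k = (if dom k = dom g then f (g \<cdot> inv k) else 0)"

lemma bij_betw_range_fibre:
  "bij_betw (\<lambda>h. inv h \<cdot> g) {h. rng h = rng g} {k. dom k = dom g}"
  by (rule bij_betw_byWitness[where f' = "\<lambda>k. g \<cdot> inv k"]) (auto simp: inv_mult)

lemma conv_eq_mat_apply: "conv G f \<xi> = mat_apply (conv_matrix f) \<xi>"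
proof
  fix g
  have "conv G f \<xi> g = (\<Sum>\<^sub>\<infinity>h\<in>{h. rng h = rng g}. f (g \<cdot> inv (inv h \<cdot> g)) * \<xi> (inv h \<cdot> g))"
    unfolding conv_def by (intro infsum_cong) (auto simp: inv_mult)
  also have "\<dots> = (\<Sum>\<^sub>\<infinity>k\<in>{k. dom k = dom g}. f (g \<cdot> inv k) * \<xi> k)"
    using bij_betw_range_fibre by (rule infsum_reindex_bij_betw)
  also have "\<dots> = mat_apply (conv_matrix f) \<xi> g"
    unfolding mat_apply_def conv_matrix_def by (rule infsum_cong_neutral) auto
  finally show "conv G f \<xi> g = mat_apply (conv_matrix f) \<xi> g" .
qed

lemma conv_matrix_invol: "conv_matrix (invol G f) = (\<lambda>g k. cnj (conv_matrix f k g))"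
  by (auto simp: fun_eq_iff conv_matrix_def invol_def inv_mult)

lemma conv_matrix_conv:
  "conv_matrix (conv G f1 f2) = (\<lambda>g k. mat_apply (conv_matrix f1) (\<lambda>l. conv_matrix f2 l k) g)"
proof (intro ext)
  fix g k
  show "conv_matrix (conv G f1 f2) g k = mat_apply (conv_matrix f1) (\<lambda>l. conv_matrix f2 l k) g"
  proof (cases "dom k = dom g")
    case True
    have "conv G f1 f2 (g \<cdot> inv k) = conv G f1 (\<lambda>l. conv_matrix f2 l k) g"
      unfolding conv_def conv_matrix_def
      using True by (intro infsum_cong_neutral) (auto simp: mult_assoc)
    with True show ?thesis
      unfolding conv_eq_mat_apply[of f1 "\<lambda>l. conv_matrix f2 l k"] by (simp add: conv_matrix_def[of "conv G f1 f2"])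
  next
    case False
    have "mat_apply (conv_matrix f1) (\<lambda>l. conv_matrix f2 l k) g = 0"
      unfolding mat_apply_def by (rule infsum_0) (use False in \<open>auto simp: conv_matrix_def\<close>)
    then show ?thesis using False by (simp add: conv_matrix_def)
  qed
qed

lemma conv_fibre_eq_sum:
  assumes "finite F" "F \<subseteq> {h. rng h = rng g}" "\<And>h. rng h = rng g \<Longrightarrow> h \<notin> F \<Longrightarrow> f h * \<xi> (inv h \<cdot> g) = 0"
  shows "conv G f \<xi> g = (\<Sum>h\<in>F. f h * \<xi> (inv h \<cdot> g))"
proof -
  have "conv G f \<xi> g = infsum (\<lambda>h. f h * \<xi> (inv h \<cdot> g)) F"
    unfolding conv_def by (rule infsum_cong_neutral) (use assms in auto)
  then show ?thesis using assms(1) by simp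
qed

lemma invol_conv: "invol G (conv G f1 f2) = conv G (invol G f2) (invol G f1)"
proof
  fix g
  have "invol G (conv G f1 f2) g = (\<Sum>\<^sub>\<infinity>h\<in>{h. rng h = dom g}. cnj (f1 h * f2 (inv h \<cdot> inv g)))"
    unfolding invol_def conv_def by (simp only: infsum_cnj rng_inv)
  also have "\<dots> = (\<Sum>\<^sub>\<infinity>h\<in>{h. rng h = dom g}. invol G f2 (g \<cdot> h) * invol G f1 (inv (g \<cdot> h) \<cdot> g))"
    by (intro infsum_cong) (auto simp: invol_def inv_mult)
  also have "\<dots> = conv G (invol G f2) (invol G f1) g"
    unfolding conv_def
    by (rule infsum_reindex_bij_betw[where f = "\<lambda>k. invol G f2 k * invol G f1 (inv k \<cdot> g)"],
        rule bij_betw_byWitness[where f' = "\<lambda>k. inv g \<cdot> k"]) auto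
  finally show "invol G (conv G f1 f2) g = conv G (invol G f2) (invol G f1) g" .
qed

lemma conv_indicator_left:
  assumes "A \<subseteq> units G"
  shows "conv G (indicator A) \<xi> g = indicator A (rng g) * \<xi> g"
proof -
  have "conv G (indicator A) \<xi> g = (\<Sum>h\<in>{rng g}. indicator A h * \<xi> (inv h \<cdot> g))"
    by (rule conv_fibre_eq_sum) (use assms in \<open>auto simp: indicator_def\<close>)
  then show ?thesis unfolding indicator_def by simp
qed

text \<open>
  The only \<open>h\<close> in the range fibre of \<open>g\<close> for which \<open>h\<inverse> g\<close> is a unit is \<open>g\<close> itself.
\<close>

lemma conv_indicator_right:
  assumes "A \<subseteq> units G"
  shows "conv G f (indicator A) g = f g * indicator A (dom g)"
proof -
  have "conv G f (indicator A) g = (\<Sum>h\<in>{g}. f h * indicator A (inv h \<cdot> g))"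
  proof (rule conv_fibre_eq_sum)
    fix h assume h: "rng h = rng g" "h \<notin> {g}"
    have "inv h \<cdot> g \<notin> units G"
    proof
      assume u: "inv h \<cdot> g \<in> units G"
      have "rng (inv h \<cdot> g) = dom h" using h by (subst rng_mult) auto
      then have "inv h \<cdot> g = dom h" using unit_simps(1)[OF u] by simp
      then have "h \<cdot> (inv h \<cdot> g) = h" by simp
      with h show False by simp
    qed
    then show "f h * indicator A (inv h \<cdot> g) = 0" using assms by (auto simp: indicator_def)
  qed auto
  then show ?thesis unfolding indicator_def by (simp add: gdom_def)
qed

text \<open>
  Exactly what makes the convolution matrix sparse: the range and source fibres correspond to
  its rows and columns.
\<close>

definition fibre_bounded :: "('g \<Rightarrow> complex) \<Rightarrow> bool" where
  "fibre_bounded f \<longleftrightarrow> (\<exists>N C.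
     (\<forall>u. finite {h. rng h = u \<and> f h \<noteq> 0} \<and> card {h. rng h = u \<and> f h \<noteq> 0} \<le> N) \<and>
     (\<forall>u. finite {h. dom h = u \<and> f h \<noteq> 0} \<and> card {h. dom h = u \<and> f h \<noteq> 0} \<le> N) \<and>
     (\<forall>h. cmod (f h) \<le> C))"

lemma sparse_conv_matrix:
  assumes "fibre_bounded f"
  shows "\<exists>N C. sparse_matrix N C (conv_matrix f)"
proof -
  obtain N C where f: "finite {h. rng h = u \<and> f h \<noteq> 0}" "card {h. rng h = u \<and> f h \<noteq> 0} \<le> N"
    "finite {h. dom h = u \<and> f h \<noteq> 0}" "card {h. dom h = u \<and> f h \<noteq> 0} \<le> N" "cmod (f h) \<le> C" for u h
    using assms unfolding fibre_bounded_def by blast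
  have "finite {k. conv_matrix f g k \<noteq> 0} \<and> card {k. conv_matrix f g k \<noteq> 0} \<le> N" for g
  proof -
    let ?S = "{k. conv_matrix f g k \<noteq> 0}" and ?T = "{h. rng h = rng g \<and> f h \<noteq> 0}"
    have sub: "(\<lambda>k. g \<cdot> inv k) ` ?S \<subseteq> ?T" by (auto simp: conv_matrix_def split: if_splits)
    have inj: "inj_on (\<lambda>k. g \<cdot> inv k) ?S"
    proof (rule inj_on_inverseI[where g = "\<lambda>h. inv h \<cdot> g"])
      fix k assume "k \<in> ?S"
      then have "dom k = dom g" by (auto simp: conv_matrix_def split: if_splits)
      then show "inv (g \<cdot> inv k) \<cdot> g = k" by (simp add: inv_mult)
    qed
    show ?thesis
      using inj_on_finite[OF inj sub f(1)] card_inj_on_le[OF inj sub f(1)] f(2) by (meson order_trans)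
  qed
  moreover have "finite {g. conv_matrix f g k \<noteq> 0} \<and> card {g. conv_matrix f g k \<noteq> 0} \<le> N" for k
  proof -
    let ?S = "{g. conv_matrix f g k \<noteq> 0}" and ?T = "{h. dom h = rng k \<and> f h \<noteq> 0}"
    have sub: "(\<lambda>g. g \<cdot> inv k) ` ?S \<subseteq> ?T" by (auto simp: conv_matrix_def split: if_splits)
    have inj: "inj_on (\<lambda>g. g \<cdot> inv k) ?S"
      by (rule inj_on_inverseI[where g = "\<lambda>h. h \<cdot> k"]) (auto simp: conv_matrix_def split: if_splits)
    show ?thesis
      using inj_on_finite[OF inj sub f(3)] card_inj_on_le[OF inj sub f(3)] f(4) by (meson order_trans)
  qed
  moreover have "cmod (conv_matrix f g k) \<le> C" for g k
    using f(5) order_trans[OF norm_ge_zero f(5)] by (simp add: conv_matrix_def)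
  ultimately have "sparse_matrix N C (conv_matrix f)" by (simp add: sparse_matrix_def)
  then show ?thesis by blast
qed

lemma fibre_bounded_rows:
  assumes "fibre_bounded f"
  shows "finite {k. conv_matrix f g k \<noteq> 0}"
  using sparse_conv_matrix[OF assms] by (auto dest: sparse_matrixD(1))

lemma conv_assoc:
  assumes "fibre_bounded f1" "fibre_bounded f2"
  shows "conv G (conv G f1 f2) \<xi> = conv G f1 (conv G f2 \<xi>)"
proof -
  have "conv G (conv G f1 f2) \<xi> =
      mat_apply (\<lambda>g k. mat_apply (conv_matrix f1) (\<lambda>l. conv_matrix f2 l k) g) \<xi>"
    by (rule conv_eq_mat_apply[of "conv G f1 f2", unfolded conv_matrix_conv])
  also have "\<dots> = mat_apply (conv_matrix f1) (mat_apply (conv_matrix f2) \<xi>)"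
    by (rule mat_apply_mat_apply[symmetric]) (intro fibre_bounded_rows assms)+
  finally show ?thesis by (simp only: conv_eq_mat_apply)
qed

lemma conv_add_left:
  assumes "fibre_bounded f1" "fibre_bounded f2"
  shows "conv G (\<lambda>x. f1 x + f2 x) \<xi> g = conv G f1 \<xi> g + conv G f2 \<xi> g"
proof -
  have "conv_matrix (\<lambda>x. f1 x + f2 x) = (\<lambda>g k. conv_matrix f1 g k + conv_matrix f2 g k)"
    by (auto simp: fun_eq_iff conv_matrix_def)
  then show ?thesis
    using mat_apply_add_left[OF fibre_bounded_rows[OF assms(1)] fibre_bounded_rows[OF assms(2)]]
    by (simp add: conv_eq_mat_apply)
qed

lemma conv_diff_right:
  assumes "fibre_bounded f"
  shows "conv G f (\<lambda>x. \<xi> x - \<eta> x) g = conv G f \<xi> g - conv G f \<eta> g"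
  using mat_apply_diff[OF fibre_bounded_rows[OF assms]] by (simp add: conv_eq_mat_apply)

lemma conv_add_right:
  assumes "fibre_bounded f"
  shows "conv G f (\<lambda>x. \<xi> x + \<eta> x) g = conv G f \<xi> g + conv G f \<eta> g"
  using mat_apply_add[OF fibre_bounded_rows[OF assms]] by (simp add: conv_eq_mat_apply)

lemma conv_zero_left [simp]: "conv G (\<lambda>x. 0) f = (\<lambda>x. 0)"
  by (simp add: conv_def fun_eq_iff)

lemma conv_zero_right [simp]: "conv G f (\<lambda>x. 0) = (\<lambda>x. 0)"
  by (simp add: conv_def fun_eq_iff)

lemma reg_rep_bounded_ops:
  assumes "fibre_bounded f"
  shows "reg_rep G f \<in> bounded_ops"
proof -
  obtain N C where M: "sparse_matrix N C (conv_matrix f)" using sparse_conv_matrix[OF assms] by blast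
  note rows = fibre_bounded_rows[OF assms]
  show ?thesis
    unfolding bounded_ops_def reg_rep_def conv_eq_mat_apply
    using mat_apply_ell2[OF M]
    by (auto simp: ell2_add ell2_scale mat_apply_add[OF rows] mat_apply_scale[OF rows] fun_eq_iff)
qed

lemma op_adjoint_reg_rep:
  assumes "fibre_bounded f" "fibre_bounded (invol G f)"
  shows "op_adjoint (reg_rep G f) = reg_rep G (invol G f)"
proof (rule op_adjointI)
  show "reg_rep G (invol G f) \<in> bounded_ops" using assms(2) by (rule reg_rep_bounded_ops)
  obtain N C where M: "sparse_matrix N C (conv_matrix f)" using sparse_conv_matrix[OF assms(1)] by blast
  show "ell2_inner (reg_rep G f \<xi>) \<eta> = ell2_inner \<xi> (reg_rep G (invol G f) \<eta>)"
    if "\<xi> \<in> ell2" "\<eta> \<in> ell2" for \<xi> \<eta>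
    using mat_apply_inner[OF M that] that
    by (simp add: reg_rep_def conv_eq_mat_apply conv_matrix_invol)
qed

text \<open>
  The inner convolution has to stay square-summable, as \<open>reg_rep\<close> sends everything else to zero.
\<close>

lemma reg_rep_conv:
  assumes "fibre_bounded f1" "fibre_bounded f2"
  shows "reg_rep G (conv G f1 f2) = reg_rep G f1 \<circ> reg_rep G f2"
proof -
  obtain N C where "sparse_matrix N C (conv_matrix f2)" using sparse_conv_matrix[OF assms(2)] by blast
  then have "conv G f2 \<xi> \<in> ell2" if "\<xi> \<in> ell2" for \<xi>
    using mat_apply_ell2(1) that by (simp add: conv_eq_mat_apply)
  then show ?thesis
    by (auto simp: fun_eq_iff reg_rep_def conv_assoc[OF assms])
qed

lemma reg_rep_add:
  assumes "fibre_bounded f1" "fibre_bounded f2"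
  shows "reg_rep G (\<lambda>x. f1 x + f2 x) = (\<lambda>\<xi> x. reg_rep G f1 \<xi> x + reg_rep G f2 \<xi> x)"
  by (auto simp: fun_eq_iff reg_rep_def conv_add_left[OF assms])

end

section \<open>Compactly supported functions and partitions of unity\<close>

lemma Cc_I:
  fixes f :: "'a::t2_space \<Rightarrow> complex"
  assumes "continuous_on UNIV f" "compact K" "\<And>x. x \<notin> K \<Longrightarrow> f x = 0"
  shows "f \<in> Cc"
proof -
  have "closure {x. f x \<noteq> 0} \<subseteq> K"
    using assms by (intro closure_minimal compact_imp_closed) auto
  then have "compact (K \<inter> closure {x. f x \<noteq> 0})" "K \<inter> closure {x. f x \<noteq> 0} = closure {x. f x \<noteq> 0}"
    using assms(2) by (auto intro: compact_Int_closed)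
  then show ?thesis using assms(1) by (simp add: Cc_def)
qed

lemma Cc_E:
  assumes "f \<in> Cc"
  obtains K where "continuous_on UNIV f" "compact K" "\<And>x. x \<notin> K \<Longrightarrow> f x = 0"
proof (rule that[of "closure {x. f x \<noteq> 0}"])
  show "f x = 0" if "x \<notin> closure {x. f x \<noteq> 0}" for x
    using that closure_subset[of "{x. f x \<noteq> 0}"] by auto
qed (use assms in \<open>auto simp: Cc_def\<close>)

lemma Cc_zero: "(\<lambda>x::'a::t2_space. 0) \<in> Cc"
  by (rule Cc_I[of _ "{}"]) auto

lemma Cc_add:
  fixes f g :: "'a::t2_space \<Rightarrow> complex"
  assumes "f \<in> Cc" "g \<in> Cc"
  shows "(\<lambda>x. f x + g x) \<in> Cc"
proof -
  obtain K L where "continuous_on UNIV f" "compact K" "\<And>x. x \<notin> K \<Longrightarrow> f x = 0"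
    "continuous_on UNIV g" "compact L" "\<And>x. x \<notin> L \<Longrightarrow> g x = 0"
    using assms by (metis Cc_E)
  then show ?thesis by (intro Cc_I[of _ "K \<union> L"] continuous_intros) auto
qed

lemma Cc_sum:
  fixes f :: "'i \<Rightarrow> 'a::t2_space \<Rightarrow> complex"
  assumes "\<And>j. j \<in> J \<Longrightarrow> f j \<in> Cc"
  shows "(\<lambda>x. \<Sum>j\<in>J. f j x) \<in> Cc"
  using assms by (induction J rule: infinite_finite_induct) (auto simp: Cc_zero Cc_add)

lemma Cc_mult_left:
  fixes f h :: "'a::t2_space \<Rightarrow> complex"
  assumes "f \<in> Cc" "continuous_on UNIV h"
  shows "(\<lambda>x. h x * f x) \<in> Cc"
  using assms(1)
proof (rule Cc_E)
  fix K assume "continuous_on UNIV f" "compact K" "\<And>x. x \<notin> K \<Longrightarrow> f x = 0"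
  then show ?thesis using assms(2) by (intro Cc_I[of _ K] continuous_intros) auto
qed

text \<open>
  The open sets \<open>V\<close> and \<open>- L\<close> cover the space, and the extended function vanishes on the second.
\<close>

lemma continuous_on_extend_zero:
  fixes F :: "'a::topological_space \<Rightarrow> 'b::{topological_space, zero}"
  assumes "open V" "closed L" "L \<subseteq> V" "continuous_on V F" "\<And>x. x \<in> V - L \<Longrightarrow> F x = 0"
  shows "continuous_on UNIV (\<lambda>x. if x \<in> V then F x else 0)"
proof -
  have "continuous_on V (\<lambda>x. if x \<in> V then F x else 0)"
    using assms(4) by (rule continuous_on_eq) simp
  moreover have "continuous_on (- L) (\<lambda>x. if x \<in> V then F x else 0)"
    by (rule continuous_on_eq[OF continuous_on_const[where c = 0]]) (use assms(5) in auto)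
  ultimately have "continuous_on (V \<union> - L) (\<lambda>x. if x \<in> V then F x else 0)"
    using assms(1,2) by (intro continuous_on_open_Un) auto
  moreover have "V \<union> - L = UNIV" using assms(3) by auto
  ultimately show ?thesis by simp
qed

text \<open>
  A locally compact Hausdorff space is completely regular and has a neighbourhood base of compact
  sets. The function is made to vanish outside an open set with compact neighbourhood \<open>L\<close>
  inside \<open>U\<close>.
\<close>

lemma bump_function:
  fixes x :: "'a::t2_space"
  assumes lc: "locally_compact_space (euclidean :: 'a topology)" and U: "open U" "x \<in> U"
  obtains u :: "'a \<Rightarrow> real" and L where
    "continuous_on UNIV u" "\<And>y. 0 \<le> u y" "u x = 1" "compact L" "L \<subseteq> U" "\<And>y. y \<notin> L \<Longrightarrow> u y = 0"
proof -
  have H: "Hausdorff_space (euclidean :: 'a topology)"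
    by (metis Hausdorff_space_def disjnt_def hausdorff open_openin topspace_euclidean)
  have "neighbourhood_base_of (compactin euclidean) (euclidean :: 'a topology)"
    using lc H locally_compact_space_neighbourhood_base by blast
  then obtain W L where WL: "open W" "compact L" "x \<in> W" "W \<subseteq> L" "L \<subseteq> U"
    using U unfolding neighbourhood_base_of by (metis open_openin compactin_euclidean_iff)
  have "completely_regular_space (euclidean :: 'a topology)"
    using lc H locally_compact_regular_imp_completely_regular_space by blast
  moreover have "closedin euclidean (- W)" "x \<in> topspace euclidean - (- W)"
    using WL by (auto simp flip: closed_closedin)
  ultimately obtain v :: "'a \<Rightarrow> real" where
    v: "continuous_map euclidean (top_of_set {0..1}) v" "v x = 0" "v ` (- W) \<subseteq> {1}"
    unfolding completely_regular_space_def by meson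
  have v': "continuous_on UNIV v" "\<And>y. v y \<le> 1"
    using v(1) by (auto simp: continuous_map_in_subtopology)
  show thesis
  proof (rule that[of "\<lambda>y. 1 - v y" L])
    show "1 - v y = 0" if "y \<notin> L" for y using that WL v(3) by auto
  qed (use v v' WL in \<open>auto intro!: continuous_intros\<close>)
qed

text \<open>
  Bump functions around the points of \<open>K\<close>, finitely many of which have a positive sum \<open>H\<close> on
  \<open>K\<close>, are grouped by the member of the cover that contains their support.
  Dividing by \<open>max \<delta> H\<close>, where \<open>\<delta>\<close> is a positive lower bound of \<open>H\<close> on \<open>K\<close>, normalises the sum on
  \<open>K\<close> and keeps the functions continuous where \<open>H\<close> vanishes.
\<close>

lemma compact_partition_of_unity:
  fixes K :: "'a::t2_space set" and U :: "'i \<Rightarrow> 'a set"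
  assumes lc: "locally_compact_space (euclidean :: 'a topology)"
    and K: "compact K" "K \<subseteq> (\<Union>j\<in>J. U j)" and J: "finite J" and U: "\<forall>j\<in>J. open (U j)"
  obtains h :: "'i \<Rightarrow> 'a \<Rightarrow> real" and L where
    "\<forall>j. continuous_on UNIV (h j)" "\<forall>j x. 0 \<le> h j x"
    "\<forall>j\<in>J. compact (L j) \<and> L j \<subseteq> U j" "\<forall>j x. x \<notin> L j \<longrightarrow> h j x = 0"
    "\<forall>x\<in>K. (\<Sum>j\<in>J. h j x) = 1"
proof -
  have "\<forall>x\<in>K. \<exists>j. j \<in> J \<and> x \<in> U j" using K(2) by blast
  then obtain j where jJ: "\<And>x. x \<in> K \<Longrightarrow> j x \<in> J" and jU: "\<And>x. x \<in> K \<Longrightarrow> x \<in> U (j x)"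
    by (metis (no_types))
  let ?bump = "\<lambda>x u L. continuous_on UNIV (u :: 'a \<Rightarrow> real) \<and> (\<forall>y. 0 \<le> u y) \<and> u x = 1 \<and>
      compact L \<and> L \<subseteq> U (j x) \<and> (\<forall>y. y \<notin> L \<longrightarrow> u y = 0)"
  have "\<exists>u L. ?bump x u L" if x: "x \<in> K" for x
    by (rule bump_function[OF lc bspec[OF U jJ[OF x]] jU[OF x]]) blast
  then have "\<forall>x\<in>K. \<exists>u. \<exists>L. ?bump x u L" by blast
  from bchoice[OF this] obtain u where "\<forall>x\<in>K. \<exists>L. ?bump x (u x) L" ..
  from bchoice[OF this] obtain L where bump: "\<forall>x\<in>K. ?bump x (u x) (L x)" ..
  then have u: "\<And>x. x \<in> K \<Longrightarrow> continuous_on UNIV (u x)" "\<And>x y. x \<in> K \<Longrightarrow> 0 \<le> u x y"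
      "\<And>x. x \<in> K \<Longrightarrow> u x x = 1"
    and L: "\<And>x. x \<in> K \<Longrightarrow> compact (L x)" "\<And>x. x \<in> K \<Longrightarrow> L x \<subseteq> U (j x)"
      "\<And>x y. x \<in> K \<Longrightarrow> y \<notin> L x \<Longrightarrow> u x y = 0"
    by blast+
  have "open {y. 0 < u x y}" if "x \<in> K" for x
    using that u(1) by (intro open_Collect_less) auto
  moreover have "K \<subseteq> (\<Union>x\<in>K. {y. 0 < u x y})" using u(3) by force
  ultimately obtain T where T: "T \<subseteq> K" "finite T" "K \<subseteq> (\<Union>x\<in>T. {y. 0 < u x y})"
    using compactE_image[OF K(1), of K "\<lambda>x. {y. 0 < u x y}"] by blast
  define H where "H y = (\<Sum>x\<in>T. u x y)" for y
  have Hc: "continuous_on UNIV H"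
    unfolding H_def[abs_def] using T(1) u(1) by (intro continuous_intros) auto
  have Hpos: "0 < H y" if y: "y \<in> K" for y
  proof -
    obtain x where "x \<in> T" "0 < u x y" using T(3) y by blast
    then show ?thesis unfolding H_def using T u(2) by (intro sum_pos2[of T x]) auto
  qed
  have "\<exists>\<delta>>0. \<forall>y\<in>K. \<delta> \<le> H y"
  proof (cases "K = {}")
    case False
    then obtain y where "y \<in> K" "\<forall>z\<in>K. H y \<le> H z"
      using continuous_attains_inf[OF K(1) _ continuous_on_subset[OF Hc]] by auto
    then show ?thesis using Hpos by blast
  qed (auto intro: exI[of _ 1])
  then obtain \<delta> where \<delta>: "0 < \<delta>" "\<And>y. y \<in> K \<Longrightarrow> \<delta> \<le> H y" by blast
  define h where "h i y = (\<Sum>x\<in>{x\<in>T. j x = i}. u x y) / max \<delta> (H y)" for i y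
  define L' where "L' i = (\<Union>x\<in>{x\<in>T. j x = i}. L x)" for i
  have mx: "0 < max \<delta> (H y)" for y using \<delta>(1) by auto
  have h_cont: "continuous_on UNIV (h i)" for i
    unfolding h_def[abs_def] using T(1) u(1) Hc mx
    by (intro continuous_intros) (auto simp: less_le)
  have h_nonneg: "0 \<le> h i y" for i y
    unfolding h_def using T(1) u(2) mx[of y] by (intro divide_nonneg_pos sum_nonneg) auto
  have h_off: "h i y = 0" if "y \<notin> L' i" for i y
  proof -
    have "(\<Sum>x\<in>{x\<in>T. j x = i}. u x y) = 0"
      using that T(1) L(3) by (intro sum.neutral) (auto simp: L'_def)
    then show ?thesis by (simp add: h_def)
  qed
  have L': "compact (L' i)" "L' i \<subseteq> U i" for i
  proof -
    show "compact (L' i)" unfolding L'_def using T(1,2) L(1) by (intro compact_UN) auto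
    show "L' i \<subseteq> U i" unfolding L'_def using T(1) L(2) by blast
  qed
  have h_sum: "(\<Sum>i\<in>J. h i y) = 1" if y: "y \<in> K" for y
  proof -
    have "(\<Sum>i\<in>J. \<Sum>x\<in>{x\<in>T. j x = i}. u x y) = H y"
      unfolding H_def using T(1) jJ by (intro sum.group J T(2)) auto
    then have "(\<Sum>i\<in>J. h i y) = H y / max \<delta> (H y)"
      by (simp add: h_def sum_divide_distrib[symmetric])
    then show ?thesis using \<delta>(2)[OF y] mx[of y] by (simp add: max_def)
  qed
  show thesis
    by (rule that[of h L']) (use h_cont h_nonneg h_off L' h_sum in auto)
qed

section \<open>Convolution in an etale groupoid\<close>

locale etale =
  fixes G :: "'g::t2_space groupoid"
  assumes etale: "etale_groupoid G"
begin

sublocale groupoid_algebra G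
  using etale by unfold_locales (simp add: etale_groupoid_def topological_groupoid_def)

lemma locally_compact: "locally_compact_space (euclidean :: 'g topology)"
  and continuous_inv: "continuous_on UNIV inv"
  and basis: "topological_basis (open_bisections G)"
  using etale by (auto simp: etale_groupoid_def topological_groupoid_def)

lemma continuous_on_mult:
  assumes "continuous_on S a" "continuous_on S b" "\<And>x. x \<in> S \<Longrightarrow> dom (a x) = rng (b x)"
  shows "continuous_on S (\<lambda>x. a x \<cdot> b x)"
proof -
  have "continuous_on (composable G) (\<lambda>(g, h). g \<cdot> h)"
    using etale by (simp add: etale_groupoid_def topological_groupoid_def)
  moreover have "(\<lambda>x. (a x, b x)) ` S \<subseteq> composable G" using assms(3) by (auto simp: composable_iff)
  ultimately show ?thesis using continuous_on_compose2[OF _ continuous_on_Pair[OF assms(1,2)]] by fastforce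
qed

lemma continuous_rng: "continuous_on UNIV rng" and continuous_dom: "continuous_on UNIV dom"
  unfolding grng_def[abs_def] gdom_def[abs_def]
  by (auto intro!: continuous_on_mult continuous_inv)

lemma closed_composable: "closed {p. dom (fst p) = rng (snd p)}"
  by (intro closed_Collect_eq continuous_on_compose2[OF continuous_dom]
      continuous_on_compose2[OF continuous_rng] continuous_intros) auto

text \<open>
  The local section \<open>s\<close> of the range map is the form in which bisections are used below.
\<close>

lemma open_bisection_rng:
  assumes "S \<in> open_bisections G"
  obtains s where "open S" "open (rng ` S)" "continuous_on (rng ` S) s"
    "\<forall>g\<in>S. s (rng g) = g" "inj_on rng S"
proof -
  obtain s where s: "open S" "open (rng ` S)" "homeomorphism S (rng ` S) rng s"
    using assms unfolding open_bisections_def bisection_def by blast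
  moreover from s(3) have "inj_on rng S" by (metis homeomorphism_apply1 inj_on_inverseI)
  ultimately show thesis using that[of s] by (auto simp: homeomorphism_def)
qed

lemma open_bisection_dom:
  assumes "S \<in> open_bisections G"
  obtains s where "open S" "open (dom ` S)" "continuous_on (dom ` S) s"
    "\<forall>g\<in>S. s (dom g) = g" "inj_on dom S"
proof -
  obtain s where s: "open S" "open (dom ` S)" "homeomorphism S (dom ` S) dom s"
    using assms unfolding open_bisections_def bisection_def by blast
  moreover from s(3) have "inj_on dom S" by (metis homeomorphism_apply1 inj_on_inverseI)
  ultimately show thesis using that[of s] by (auto simp: homeomorphism_def)
qed

text \<open>
  The open set \<open>rng ` S\<close> consists of units and contains every unit that lies in the open bisection
  \<open>S\<close>.
\<close>

lemma open_units: "open (units G)"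
proof (subst open_subopen, intro ballI)
  fix u assume "u \<in> units G"
  then obtain S where S: "S \<in> open_bisections G" "u \<in> S"
    using topological_basisE[OF basis open_UNIV] by blast
  then have "u \<in> rng ` S" using \<open>u \<in> units G\<close> by (metis imageI unit_simps(1))
  moreover have "open (rng ` S)" using S(1) by (rule open_bisection_rng)
  ultimately show "\<exists>T. open T \<and> u \<in> T \<and> T \<subseteq> units G" by auto
qed

lemma compact_finite_bisection_cover:
  assumes "compact K"
  obtains \<F> where "finite \<F>" "\<F> \<subseteq> open_bisections G" "K \<subseteq> \<Union>\<F>"
proof -
  have "K \<subseteq> \<Union>(open_bisections G)" using topological_basisE[OF basis open_UNIV] by blast
  then obtain \<F> where "\<F> \<subseteq> open_bisections G" "finite \<F>" "K \<subseteq> \<Union>\<F>"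
    using topological_basis_open[OF basis] by (rule compactE[OF assms])
  then show thesis by (intro that[of \<F>])
qed

text \<open>
  Each of finitely many bisections covering the support meets each fibre in at most one point.
\<close>

lemma Cc_fibre_bounded:
  assumes "f \<in> Cc"
  shows "fibre_bounded f"
  using assms
proof (rule Cc_E)
  fix K assume f: "continuous_on UNIV f" "compact K" "\<And>x. x \<notin> K \<Longrightarrow> f x = 0"
  obtain \<F> where \<F>: "finite \<F>" "\<F> \<subseteq> open_bisections G" "K \<subseteq> \<Union>\<F>"
    using compact_finite_bisection_cover[OF f(2)] .
  have fibres: "finite {h. p h = u \<and> f h \<noteq> 0} \<and> card {h. p h = u \<and> f h \<noteq> 0} \<le> card \<F>"
    if inj: "\<And>S. S \<in> \<F> \<Longrightarrow> inj_on p S" for p :: "'g \<Rightarrow> 'g" and u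
  proof -
    let ?X = "{h. p h = u \<and> f h \<noteq> 0}"
    have "\<exists>S. S \<in> \<F> \<and> h \<in> S" if "h \<in> ?X" for h using that f(3)[of h] \<F>(3) by auto
    then have "\<forall>h\<in>?X. \<exists>S. S \<in> \<F> \<and> h \<in> S" by blast
    from bchoice[OF this] obtain S where S': "\<forall>h\<in>?X. S h \<in> \<F> \<and> h \<in> S h" ..
    then have S: "S h \<in> \<F>" "h \<in> S h" if "h \<in> ?X" for h using that by simp_all
    have "inj_on S ?X"
    proof (rule inj_onI)
      fix h k assume hk: "h \<in> ?X" "k \<in> ?X" "S h = S k"
      then have "inj_on p (S h)" "h \<in> S h" "k \<in> S h" "p h = p k" using S inj by auto
      then show "h = k" by (simp add: inj_onD)
    qed
    moreover have "S ` ?X \<subseteq> \<F>" using S(1) by blast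
    ultimately show ?thesis using inj_on_finite[of S ?X \<F>] card_inj_on_le[of S ?X \<F>] \<F>(1) by simp
  qed
  have r: "inj_on rng S" if S: "S \<in> \<F>" for S
    by (rule open_bisection_rng[OF subsetD[OF \<F>(2) S]])
  have d: "inj_on dom S" if S: "S \<in> \<F>" for S
    by (rule open_bisection_dom[OF subsetD[OF \<F>(2) S]])
  have "compact (f ` K)" by (rule compact_continuous_image[OF continuous_on_subset[OF f(1)] f(2)]) simp
  then have "bounded (f ` K)" by (rule compact_imp_bounded)
  then obtain C where C: "\<And>z. z \<in> f ` K \<Longrightarrow> cmod z \<le> C" unfolding bounded_iff by blast
  have "cmod (f h) \<le> \<bar>C\<bar>" for h
    using C[of "f h"] f(3)[of h] by (cases "h \<in> K") auto
  then show ?thesis unfolding fibre_bounded_def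
    by (intro exI[of _ "card \<F>"] exI[of _ "\<bar>C\<bar>"] conjI allI) (use fibres[OF r] fibres[OF d] in auto)
qed

lemma invol_Cc:
  assumes "f \<in> Cc"
  shows "invol G f \<in> Cc"
  using assms
proof (rule Cc_E)
  fix K assume f: "continuous_on UNIV f" "compact K" "\<And>x. x \<notin> K \<Longrightarrow> f x = 0"
  show ?thesis
  proof (rule Cc_I)
    show "continuous_on UNIV (invol G f)"
      unfolding invol_def[abs_def]
      by (intro continuous_intros continuous_on_compose2[OF f(1)] continuous_inv) auto
    show "compact (inv ` K)"
      by (rule compact_continuous_image[OF continuous_on_subset[OF continuous_inv] f(2)]) simp
    show "invol G f x = 0" if "x \<notin> inv ` K" for x
      using that f(3)[of "inv x"] by (auto simp: invol_def image_iff) (metis inv_inv)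
  qed
qed

text \<open>
  The convolution sum at \<open>g\<close> has at most one nonzero term, at the unique \<open>h\<close> in \<open>V\<close> with the same
  range as \<open>g\<close>. Through the local section of \<open>V\<close> it depends continuously on \<open>g\<close>. It vanishes
  unless \<open>rng g\<close> lies in the compact set \<open>rng ` K\<close>, which gives continuity everywhere, and the support is
  contained in the compact product of the two supports.
\<close>

lemma conv_Cc_bisection:
  assumes V: "V \<in> open_bisections G" and f1: "continuous_on UNIV f1" and f2: "f2 \<in> Cc"
    and K: "compact K" "K \<subseteq> V" "\<And>x. x \<notin> K \<Longrightarrow> f1 x = 0"
  shows "conv G f1 f2 \<in> Cc"
  using f2
proof (rule Cc_E)
  fix K2 assume f2: "continuous_on UNIV f2" "compact K2" "\<And>x. x \<notin> K2 \<Longrightarrow> f2 x = 0"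
  obtain s where "open V" and s: "open (rng ` V)" "continuous_on (rng ` V) s"
    and s_rng: "\<forall>g\<in>V. s (rng g) = g" and "inj_on rng V"
    by (rule open_bisection_rng[OF V]) (rule that)
  define W where "W = {g. rng g \<in> rng ` V}"
  have sW: "s (rng g) \<in> V" "rng (s (rng g)) = rng g" if "g \<in> W" for g
    using that s_rng by (auto simp: W_def)
  define F where "F g = f1 (s (rng g)) * f2 (inv (s (rng g)) \<cdot> g)" for g
  have eq: "conv G f1 f2 = (\<lambda>g. if g \<in> W then F g else 0)"
  proof
    fix g
    have "conv G f1 f2 g = (\<Sum>h\<in>(if g \<in> W then {s (rng g)} else {}). f1 h * f2 (inv h \<cdot> g))"
    proof (rule conv_fibre_eq_sum)
      fix h assume h: "rng h = rng g" "h \<notin> (if g \<in> W then {s (rng g)} else {})"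
      have "h \<notin> V"
      proof
        assume "h \<in> V"
        then have "g \<in> W" "s (rng g) = h" using h(1) s_rng by (auto simp: W_def intro: rev_image_eqI)
        with h(2) show False by simp
      qed
      then show "f1 h * f2 (inv h \<cdot> g) = 0" using K(2,3) by auto
    qed (use sW in auto)
    then show "conv G f1 f2 g = (if g \<in> W then F g else 0)" by (simp add: F_def)
  qed
  show ?thesis
  proof (rule Cc_I)
    have "open (rng -` (rng ` V))" using s(1) continuous_rng by (simp add: open_vimage)
    then have "open W" by (simp add: W_def vimage_def)
    moreover have "compact (rng ` K)"
      by (rule compact_continuous_image[OF continuous_on_subset[OF continuous_rng] K(1)]) simp
    then have "closed (rng -` (rng ` K))"
      using continuous_rng by (intro closed_vimage compact_imp_closed)
    moreover have "rng -` (rng ` K) \<subseteq> W" using K(2) by (auto simp: W_def)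
    moreover have "continuous_on W F"
    proof -
      have "continuous_on W (\<lambda>g. s (rng g))"
        by (rule continuous_on_compose2[OF s(2) continuous_on_subset[OF continuous_rng]])
          (auto simp: W_def)
      then show ?thesis
        unfolding F_def[abs_def]
        by (intro continuous_intros continuous_on_compose2[OF f1] continuous_on_compose2[OF f2(1)]
            continuous_on_mult continuous_on_compose2[OF continuous_inv]) (auto simp: sW)
    qed
    moreover have "F g = 0" if "g \<in> W - rng -` (rng ` K)" for g
    proof -
      have "s (rng g) \<notin> K" using that sW(2)[of g] by (metis DiffE imageI vimageI2)
      then show ?thesis using K(3) by (simp add: F_def)
    qed
    ultimately show "continuous_on UNIV (conv G f1 f2)"
      unfolding eq by (rule continuous_on_extend_zero)
    \<comment> \<open>compact because the composable pairs are closed\<close>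
    let ?P = "K \<times> K2 \<inter> {p. dom (fst p) = rng (snd p)}"
    have "compact ?P" using K(1) f2(2) closed_composable by (intro compact_Int_closed compact_Times)
    moreover have "continuous_on ?P (\<lambda>p. fst p \<cdot> snd p)"
      by (intro continuous_on_mult continuous_intros) auto
    ultimately show "compact ((\<lambda>p. fst p \<cdot> snd p) ` ?P)" by (rule compact_continuous_image[rotated])
    fix g assume g: "g \<notin> (\<lambda>p. fst p \<cdot> snd p) ` ?P"
    show "conv G f1 f2 g = 0"
    proof (cases "g \<in> W")
      case True
      let ?h = "s (rng g)"
      have "\<not> (?h \<in> K \<and> inv ?h \<cdot> g \<in> K2)"
      proof
        assume "?h \<in> K \<and> inv ?h \<cdot> g \<in> K2"
        then have "(?h, inv ?h \<cdot> g) \<in> ?P" using sW(2)[OF True] by simp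
        moreover have "g = fst (?h, inv ?h \<cdot> g) \<cdot> snd (?h, inv ?h \<cdot> g)" using sW(2)[OF True] by simp
        ultimately show False using g by blast
      qed
      then show ?thesis using K(3) f2(3) True by (auto simp: eq F_def)
    qed (simp add: eq)
  qed
qed

text \<open>
  A partition of unity over a finite bisection cover of the support of the first factor reduces this
  to the preceding lemma.
\<close>

lemma conv_Cc:
  assumes f1: "f1 \<in> Cc" and f2: "f2 \<in> Cc"
  shows "conv G f1 f2 \<in> Cc"
  using f1
proof (rule Cc_E)
  fix K assume K: "continuous_on UNIV f1" "compact K" "\<And>x. x \<notin> K \<Longrightarrow> f1 x = 0"
  obtain \<F> where \<F>: "finite \<F>" "\<F> \<subseteq> open_bisections G" "K \<subseteq> \<Union>\<F>"
    using compact_finite_bisection_cover[OF K(2)] .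
  have op: "\<forall>S\<in>\<F>. open S" using \<F>(2) by (auto simp: open_bisections_def)
  have cover: "K \<subseteq> (\<Union>S\<in>\<F>. S)" using \<F>(3) by simp
  obtain h :: "'g set \<Rightarrow> 'g \<Rightarrow> real" and L where "\<forall>j. continuous_on UNIV (h j)" "\<forall>j x. 0 \<le> h j x"
    "\<forall>j\<in>\<F>. compact (L j) \<and> L j \<subseteq> j" "\<forall>j x. x \<notin> L j \<longrightarrow> h j x = 0"
    "\<forall>x\<in>K. (\<Sum>j\<in>\<F>. h j x) = 1"
    by (rule compact_partition_of_unity[OF locally_compact K(2) cover \<F>(1) op])
      (rule that)
  then have h: "\<And>j. continuous_on UNIV (h j)" "\<And>j x. 0 \<le> h j x"
    "\<And>j. j \<in> \<F> \<Longrightarrow> compact (L j) \<and> L j \<subseteq> j" "\<And>j x. x \<notin> L j \<Longrightarrow> h j x = 0"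
    "\<And>x. x \<in> K \<Longrightarrow> (\<Sum>j\<in>\<F>. h j x) = 1"
    by simp_all
  define p where "p S x = complex_of_real (h S x) * f1 x" for S x
  have p: "p S \<in> Cc" for S
    unfolding p_def[abs_def] using f1 h(1) by (intro Cc_mult_left continuous_intros)
  have eq: "f1 = (\<lambda>x. \<Sum>S\<in>\<F>. p S x)"
  proof
    fix x show "f1 x = (\<Sum>S\<in>\<F>. p S x)"
      using h(5)[of x] K(3)[of x]
      by (cases "x \<in> K") (simp_all add: p_def sum_distrib_right[symmetric] flip: of_real_sum)
  qed
  have piece: "conv G (p S) f2 \<in> Cc" if "S \<in> \<F>" for S
  proof (rule conv_Cc_bisection[OF _ _ f2])
    show "S \<in> open_bisections G" using that \<F>(2) by blast
    show "continuous_on UNIV (p S)" using p[of S] by (simp add: Cc_def)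
    show "compact (L S)" "L S \<subseteq> S" using h(3)[OF that] by auto
    show "p S x = 0" if "x \<notin> L S" for x using h(4)[OF that] by (simp add: p_def)
  qed
  have "conv G (\<lambda>x. \<Sum>S\<in>\<F>. p S x) f2 \<in> Cc"
    using \<F>(1) piece
  proof (induction \<F> rule: finite_induct)
    case empty
    then show ?case by (simp add: Cc_zero)
  next
    case (insert S \<S>)
    have "conv G (\<lambda>x. p S x + (\<Sum>S\<in>\<S>. p S x)) f2 =
        (\<lambda>x. conv G (p S) f2 x + conv G (\<lambda>x. \<Sum>S\<in>\<S>. p S x) f2 x)"
      by (rule ext, rule conv_add_left) (intro Cc_fibre_bounded p Cc_sum)+
    then show ?case using insert by (simp add: Cc_add)
  qed
  then show ?thesis using eq by simp
qed

end

section \<open>Isometries from a paradoxical decomposition\<close>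

context groupoid_algebra
begin

text \<open>
  A term of the sum at \<open>g\<close> is the product of the conjugate of \<open>f1 k\<close> with \<open>f2 (k \<cdot> g)\<close>, and \<open>k\<close> and \<open>k \<cdot> g\<close> have
  the same range.
\<close>

lemma conv_invol_eq_zero:
  assumes "\<And>x y. f1 x \<noteq> 0 \<Longrightarrow> f2 y \<noteq> 0 \<Longrightarrow> rng x \<noteq> rng y"
  shows "conv G (invol G f1) f2 = (\<lambda>x. 0)"
proof
  fix g
  have "conv G (invol G f1) f2 g = (\<Sum>h\<in>{}. invol G f1 h * f2 (inv h \<cdot> g))"
  proof (rule conv_fibre_eq_sum)
    fix h assume "rng h = rng g"
    then show "invol G f1 h * f2 (inv h \<cdot> g) = 0"
      using assms[of "inv h" "inv h \<cdot> g"] by (auto simp: invol_def)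
  qed auto
  then show "conv G (invol G f1) f2 g = 0" by simp
qed

end

context etale
begin

text \<open>
  The function is \<open>sqrt (h\<^sub>j \<circ> d)\<close> on \<open>V j\<close> for a partition of unity \<open>h\<close> on \<open>A\<close> subordinate to the
  sources of the \<open>V j\<close>; the square root compensates for the product in \<open>f* * f\<close>. Disjoint ranges
  make \<open>rng\<close> injective on the support of \<open>f\<close>, so off the units every term of \<open>f* * f\<close> vanishes. At a
  unit \<open>g\<close> the surviving terms are indexed by the \<open>V j\<close> that have an element with source \<open>g\<close>, and
  add up to the sum of the \<open>h\<^sub>j g\<close>.
\<close>

lemma section_of_bisections:
  fixes V :: "'i \<Rightarrow> 'g set"
  assumes J: "finite J" and V: "\<And>j. j \<in> J \<Longrightarrow> V j \<in> open_bisections G"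
    and disj: "\<And>i j x y. i \<in> J \<Longrightarrow> j \<in> J \<Longrightarrow> x \<in> V i \<Longrightarrow> y \<in> V j \<Longrightarrow> rng x = rng y \<Longrightarrow> i = j"
    and A: "compact A" "(\<Union>j\<in>J. dom ` V j) = A"
  obtains f where "f \<in> Cc" "\<And>x. f x \<in> \<real>\<^sub>\<ge>\<^sub>0" "\<And>x. f x \<noteq> 0 \<Longrightarrow> \<exists>j\<in>J. x \<in> V j"
    "conv G (invol G f) f = indicator A"
proof -
  have "\<exists>s. continuous_on (dom ` V j) s \<and> (\<forall>g\<in>V j. s (dom g) = g)" if "j \<in> J" for j
    by (rule open_bisection_dom[OF V[OF that]]) blast
  then have "\<forall>j\<in>J. \<exists>s. continuous_on (dom ` V j) s \<and> (\<forall>g\<in>V j. s (dom g) = g)" by blast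
  from bchoice[OF this] obtain s
    where "\<forall>j\<in>J. continuous_on (dom ` V j) (s j) \<and> (\<forall>g\<in>V j. s j (dom g) = g)" ..
  then have s: "continuous_on (dom ` V j) (s j)" "\<And>g. g \<in> V j \<Longrightarrow> s j (dom g) = g" if "j \<in> J" for j
    using that by auto
  have openV: "open (V j)" if "j \<in> J" for j using V[OF that] by (simp add: open_bisections_def)
  have opend: "\<forall>j\<in>J. open (dom ` V j)" by (rule ballI) (rule open_bisection_dom[OF V])
  have cover: "A \<subseteq> (\<Union>j\<in>J. dom ` V j)" using A(2) by simp
  obtain h :: "'i \<Rightarrow> 'g \<Rightarrow> real" and L where "\<forall>j. continuous_on UNIV (h j)" "\<forall>j x. 0 \<le> h j x"
    "\<forall>j\<in>J. compact (L j) \<and> L j \<subseteq> dom ` V j" "\<forall>j x. x \<notin> L j \<longrightarrow> h j x = 0"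
    "\<forall>x\<in>A. (\<Sum>j\<in>J. h j x) = 1"
    by (rule compact_partition_of_unity[OF locally_compact A(1) cover J opend])
      (rule that)
  then have h: "\<And>j. continuous_on UNIV (h j)" "\<And>j x. 0 \<le> h j x"
    "\<And>j. j \<in> J \<Longrightarrow> compact (L j) \<and> L j \<subseteq> dom ` V j" "\<And>j x. x \<notin> L j \<Longrightarrow> h j x = 0"
    "\<And>x. x \<in> A \<Longrightarrow> (\<Sum>j\<in>J. h j x) = 1"
    by simp_all
  define p where "p j x = (if x \<in> V j then complex_of_real (sqrt (h j (dom x))) else 0)" for j x
  define f where "f x = (\<Sum>j\<in>J. p j x)" for x
  have sL: "compact (s j ` L j)" "s j ` L j \<subseteq> V j" if "j \<in> J" for j
  proof -
    show "compact (s j ` L j)"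
      using h(3)[OF that] by (intro compact_continuous_image continuous_on_subset[OF s(1)[OF that]]) auto
    show "s j ` L j \<subseteq> V j" using h(3)[OF that] s(2)[OF that] by fastforce
  qed
  have p_off: "p j x = 0" if "j \<in> J" "x \<notin> s j ` L j" for j x
  proof (cases "x \<in> V j")
    case True
    then have "dom x \<notin> L j" using that s(2)[OF that(1) True] by (metis imageI)
    then show ?thesis using h(4) by (simp add: p_def)
  qed (simp add: p_def)
  have "p j \<in> Cc" if j: "j \<in> J" for j
  proof (rule Cc_I[OF _ sL(1)[OF j]])
    show "continuous_on UNIV (p j)"
      unfolding p_def[abs_def]
    proof (rule continuous_on_extend_zero[OF openV[OF j] compact_imp_closed[OF sL(1)[OF j]] sL(2)[OF j]])
      have "continuous_on UNIV (\<lambda>x. h j (dom x))"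
        by (rule continuous_on_compose2[OF h(1) continuous_dom]) simp
      then show "continuous_on (V j) (\<lambda>x. complex_of_real (sqrt (h j (dom x))))"
        by (intro continuous_intros) (rule continuous_on_subset, auto)
      show "complex_of_real (sqrt (h j (dom x))) = 0" if "x \<in> V j - s j ` L j" for x
        using p_off[OF j, of x] that by (simp add: p_def)
    qed
  qed (rule p_off[OF j])
  then have fCc: "f \<in> Cc" unfolding f_def[abs_def] by (rule Cc_sum)
  have fV: "f x = complex_of_real (sqrt (h j (dom x)))" if "j \<in> J" "x \<in> V j" for j x
  proof -
    have "f x = (\<Sum>i\<in>{j}. p i x)"
      unfolding f_def by (rule sum.mono_neutral_right) (use J that disj in \<open>auto simp: p_def\<close>)
    then show ?thesis using that by (simp add: p_def)
  qed
  have f_off: "\<exists>j\<in>J. x \<in> V j" if "f x \<noteq> 0" for x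
    using that unfolding f_def by (metis (no_types, lifting) p_def sum.neutral)
  have f_inj: "x = y" if xy: "f x \<noteq> 0" "f y \<noteq> 0" "rng x = rng y" for x y
  proof -
    obtain i j where ij: "i \<in> J" "x \<in> V i" "j \<in> J" "y \<in> V j" using f_off xy by blast
    then have "i = j" using disj xy(3) by blast
    moreover have "inj_on rng (V j)" by (rule open_bisection_rng[OF V[OF ij(3)]])
    ultimately show "x = y" using ij xy(3) by (metis inj_onD)
  qed
  have "conv G (invol G f) f g = indicator A g" for g
  proof (cases "g \<in> units G")
    case False
    have "conv G (invol G f) f g = (\<Sum>h\<in>{}. invol G f h * f (inv h \<cdot> g))"
    proof (rule conv_fibre_eq_sum)
      fix h assume h: "rng h = rng g"
      have "inv h \<noteq> inv h \<cdot> g"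
      proof
        assume "inv h = inv h \<cdot> g"
        then have "rng h = g" using h mult_inv_mult_cancel[of h g] by (simp add: grng_def[of G h])
        then show False using False rng_in_units by metis
      qed
      then show "invol G f h * f (inv h \<cdot> g) = 0"
        using f_inj[of "inv h" "inv h \<cdot> g"] h by (auto simp: invol_def)
    qed auto
    moreover have "g \<notin> A" using False A(2) by auto
    ultimately show ?thesis by simp
  next
    case True
    note g = unit_simps[OF True]
    define I where "I = {j \<in> J. g \<in> dom ` V j}"
    have I: "finite I" "I \<subseteq> J" using J by (auto simp: I_def)
    have sI: "s j g \<in> V j" "dom (s j g) = g" if "j \<in> I" for j
      using that s(2) by (auto simp: I_def)
    have inj: "inj_on (\<lambda>j. inv (s j g)) I"
    proof (rule inj_onI)
      fix i j assume ij: "i \<in> I" "j \<in> I" "inv (s i g) = inv (s j g)"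
      then have "s i g = s j g" by (metis inv_inv)
      moreover have "s i g \<in> V i" "s j g \<in> V j" "i \<in> J" "j \<in> J" using sI(1) ij I(2) by auto
      ultimately show "i = j" using disj[of i j "s i g" "s j g"] by simp
    qed
    have "conv G (invol G f) f g = (\<Sum>h\<in>(\<lambda>j. inv (s j g)) ` I. invol G f h * f (inv h \<cdot> g))"
    proof (rule conv_fibre_eq_sum)
      fix h assume h: "rng h = rng g" "h \<notin> (\<lambda>j. inv (s j g)) ` I"
      have "f (inv h) = 0"
      proof (rule ccontr)
        assume "f (inv h) \<noteq> 0"
        then obtain j where j: "j \<in> J" "inv h \<in> V j" using f_off by blast
        have d: "dom (inv h) = g" using h(1) g by simp
        then have "j \<in> I" using j by (auto simp: I_def intro: rev_image_eqI)
        moreover have "h = inv (s j g)" using s(2)[OF j] d by simp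
        ultimately show False using h(2) by blast
      qed
      then show "invol G f h * f (inv h \<cdot> g) = 0" by (simp add: invol_def)
    qed (use I(1) sI g in auto)
    also have "\<dots> = (\<Sum>j\<in>I. cnj (f (s j g)) * f (s j g \<cdot> g))"
      by (simp add: sum.reindex[OF inj] invol_def)
    also have "\<dots> = (\<Sum>j\<in>I. complex_of_real (h j g))"
    proof (rule sum.cong[OF refl])
      fix j assume j: "j \<in> I"
      have "s j g \<cdot> g = s j g" using mult_units(2)[of "s j g"] sI(2)[OF j] by simp
      then show "cnj (f (s j g)) * f (s j g \<cdot> g) = complex_of_real (h j g)"
        using fV[of j "s j g"] sI[OF j] j I(2) h(2)[of j g]
        by (auto simp flip: of_real_mult)
    qed
    also have "\<dots> = (\<Sum>j\<in>J. complex_of_real (h j g))"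
    proof (rule sum.mono_neutral_left[OF J I(2)], rule ballI)
      fix j assume j: "j \<in> J - I"
      then have "j \<in> J" "g \<notin> dom ` V j" by (auto simp: I_def)
      then have "g \<notin> L j" using h(3)[of j] by auto
      then show "complex_of_real (h j g) = 0" by (simp add: h(4))
    qed
    also have "\<dots> = indicator A g"
    proof (cases "g \<in> A")
      case False
      have "h j g = 0" if j: "j \<in> J" for j
      proof (rule h(4))
        show "g \<notin> L j" using h(3)[OF j] j False A(2) by auto
      qed
      then show ?thesis using False by simp
    qed (use h(5)[of g] in \<open>simp flip: of_real_sum\<close>)
    finally show ?thesis .
  qed
  moreover have "f x \<in> \<real>\<^sub>\<ge>\<^sub>0" for x
    using fV[of _ x] f_off[of x] h(2) by (cases "f x = 0") auto
  ultimately show thesis using fCc f_off by (intro that[of f]) auto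
qed

lemma indicator_Cc:
  assumes "compact A" "open A"
  shows "(indicator A :: 'g \<Rightarrow> complex) \<in> Cc"
proof (rule Cc_I)
  have "continuous_on UNIV (\<lambda>x::'g. if x \<in> A then 1 else 0 :: complex)"
    by (rule continuous_on_extend_zero[OF assms(2) compact_imp_closed[OF assms(1)]]) auto
  moreover have "(\<lambda>x. if x \<in> A then 1 else 0) = (indicator A :: 'g \<Rightarrow> complex)"
    by (auto simp: fun_eq_iff)
  ultimately show "continuous_on UNIV (indicator A :: 'g \<Rightarrow> complex)" by (simp only:)
qed (use assms in auto)

text \<open>
  The approximating function is \<open>f\<close> itself; the point is boundedness.
\<close>

lemma reg_rep_carrier:
  assumes "f \<in> Cc"
  shows "reg_rep G f \<in> ccarrier (reduced_Cstar G)"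
proof -
  have "op_norm (\<lambda>\<xi> x. reg_rep G f \<xi> x - reg_rep G f \<xi> x) = 0"
  proof -
    have z: "ell2_norm (\<lambda>x::'g. 0) = 0" by (simp add: ell2_norm_def)
    then have "(\<lambda>x::'g. 0) \<in> {\<xi> \<in> ell2. ell2_norm \<xi> \<le> 1}" by (simp add: ell2_def)
    then have "{\<xi>::'g \<Rightarrow> complex. \<xi> \<in> ell2 \<and> ell2_norm \<xi> \<le> 1} \<noteq> {}" by blast
    then show ?thesis by (simp add: op_norm_def z)
  qed
  then show ?thesis
    using assms reg_rep_bounded_ops[OF Cc_fibre_bounded[OF assms]]
    by (auto simp: reduced_Cstar_def reduced_carrier_def intro!: bexI[of _ f])
qed

lemma reg_rep_mult:
  assumes "f1 \<in> Cc" "f2 \<in> Cc"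
  shows "cmult (reduced_Cstar G) (reg_rep G f1) (reg_rep G f2) = reg_rep G (conv G f1 f2)"
  using reg_rep_conv assms Cc_fibre_bounded by (simp add: reduced_Cstar_def)

lemma reg_rep_plus:
  assumes "f1 \<in> Cc" "f2 \<in> Cc"
  shows "cadd (reduced_Cstar G) (reg_rep G f1) (reg_rep G f2) = reg_rep G (\<lambda>x. f1 x + f2 x)"
  using reg_rep_add assms Cc_fibre_bounded by (simp add: reduced_Cstar_def)

lemma reg_rep_star:
  assumes "f \<in> Cc"
  shows "cstar (reduced_Cstar G) (reg_rep G f) = reg_rep G (invol G f)"
  using op_adjoint_reg_rep assms Cc_fibre_bounded invol_Cc by (simp add: reduced_Cstar_def)

text \<open>
  With \<open>q = f * f* + g * g*\<close> and \<open>z = e - q\<close>, the isometry relations give \<open>f* * q = f*\<close> and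
  \<open>g* * q = g*\<close>, hence \<open>f* * z = 0\<close> and \<open>g* * z = 0\<close>, so \<open>q * z = 0\<close> and \<open>z * z = e * z = z\<close>. As \<open>z\<close> is
  self-adjoint, \<open>e = q + z* * z\<close>.
\<close>

lemma orthogonal_isometries_properly_infinite:
  fixes A :: "'g set"
  defines "e \<equiv> indicator A :: 'g \<Rightarrow> complex"
  assumes A: "A \<subseteq> units G" "A \<noteq> {}" and e: "e \<in> Cc" and f: "f \<in> Cc" and g: "g \<in> Cc"
    and ff: "conv G (invol G f) f = e" and gg: "conv G (invol G g) g = e"
    and fg: "conv G (invol G f) g = (\<lambda>x. 0)" and gf: "conv G (invol G g) f = (\<lambda>x. 0)"
    and rf: "\<And>x. f x \<noteq> 0 \<Longrightarrow> rng x \<in> A \<and> dom x \<in> A" and rg: "\<And>x. g x \<noteq> 0 \<Longrightarrow> rng x \<in> A \<and> dom x \<in> A"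
  shows "cstar_le (reduced_Cstar G) 
      (reg_rep G (\<lambda>x. conv G f (invol G f) x + conv G g (invol G g) x)) (reg_rep G e)"
    and "properly_infinite (reduced_Cstar G) (reg_rep G e)"
proof -
  let ?B = "reduced_Cstar G"
  define q where "q x = conv G f (invol G f) x + conv G g (invol G g) x" for x
  define z where "z x = e x - q x" for x
  note fs = invol_Cc[OF f] and gs = invol_Cc[OF g]
  note fb = Cc_fibre_bounded
  have cff: "conv G f (invol G f) \<in> Cc" and cgg: "conv G g (invol G g) \<in> Cc"
    using f g fs gs by (simp_all add: conv_Cc)
  have q: "q \<in> Cc" unfolding q_def[abs_def] using cff cgg by (rule Cc_add)
  have z: "z \<in> Cc"
  proof -
    have "(\<lambda>x. e x + (-1) * q x) \<in> Cc" by (intro Cc_add e Cc_mult_left q continuous_intros)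
    then show ?thesis by (simp add: z_def[abs_def])
  qed
  have e_star: "invol G e = e"
  proof
    fix x
    have "inv x \<in> A \<longleftrightarrow> x \<in> A" using A(1) by (metis inv_inv subsetD unit_simps(3))
    then show "invol G e x = e x" by (simp add: invol_def e_def indicator_def)
  qed
  have e_left: "conv G e k = k" if "\<And>x. k x \<noteq> 0 \<Longrightarrow> rng x \<in> A" for k
    unfolding e_def using that by (auto simp: fun_eq_iff conv_indicator_left[OF A(1)] indicator_def)
  have e_right: "conv G k e = k" if "\<And>x. k x \<noteq> 0 \<Longrightarrow> dom x \<in> A" for k
    unfolding e_def using that by (auto simp: fun_eq_iff conv_indicator_right[OF A(1)] indicator_def)
  have ee: "conv G e e = e" by (rule e_left) (use A(1) in \<open>auto simp: e_def indicator_def split: if_splits\<close>)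
  have kz: "conv G (invol G k) z = (\<lambda>x. 0)"
    if k: "k \<in> Cc" "\<And>x. k x \<noteq> 0 \<Longrightarrow> rng x \<in> A \<and> dom x \<in> A"
      and kq: "conv G (invol G k) q = invol G k" for k
  proof
    fix x
    have ke: "conv G (invol G k) e = invol G k"
      by (rule e_right) (use k(2) in \<open>fastforce simp: invol_def\<close>)
    have "conv G (invol G k) z x = conv G (invol G k) e x - conv G (invol G k) q x"
      unfolding z_def[abs_def] by (rule conv_diff_right) (rule fb[OF invol_Cc[OF k(1)]])
    then show "conv G (invol G k) z x = 0" by (simp add: ke kq)
  qed
  have kq: "conv G (invol G k) q x = conv G (conv G (invol G k) f) (invol G f) x
      + conv G (conv G (invol G k) g) (invol G g) x" if k: "k \<in> Cc" for k x
    unfolding q_def[abs_def]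
    using k f g by (simp add: conv_add_right conv_assoc fb invol_Cc)
  have e_fs: "conv G e (invol G f) = invol G f" by (rule e_left) (use rf in \<open>fastforce simp: invol_def\<close>)
  have e_gs: "conv G e (invol G g) = invol G g" by (rule e_left) (use rg in \<open>fastforce simp: invol_def\<close>)
  have fz: "conv G (invol G f) z = (\<lambda>x. 0)"
    by (rule kz[OF f rf]) (simp_all add: fun_eq_iff kq f ff fg e_fs)
  have gz: "conv G (invol G g) z = (\<lambda>x. 0)"
    by (rule kz[OF g rg]) (simp_all add: fun_eq_iff kq g gg gf e_gs)
  have qz: "conv G q z = (\<lambda>x. 0)"
    unfolding q_def[abs_def] fun_eq_iff
    by (simp add: conv_add_left fb cff cgg conv_assoc f g fs gs fz gz)
  have eq: "conv G e q = q"
  proof -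
    have "conv G e (conv G f (invol G f)) = conv G f (invol G f)"
      using conv_assoc[OF fb[OF e] fb[OF f], of "invol G f"] e_left[of f] rf by simp
    moreover have "conv G e (conv G g (invol G g)) = conv G g (invol G g)"
      using conv_assoc[OF fb[OF e] fb[OF g], of "invol G g"] e_left[of g] rg by simp
    ultimately show ?thesis
      unfolding q_def[abs_def] by (simp add: fun_eq_iff conv_add_right fb e)
  qed
  have ez: "conv G e z = z"
    unfolding z_def[abs_def] by (simp add: fun_eq_iff conv_diff_right fb e ee eq)
  have zz: "conv G z z = z"
  proof
    fix x
    have "e = (\<lambda>x. z x + q x)" by (simp add: z_def fun_eq_iff)
    then have "conv G e z x = conv G z z x + conv G q z x"
      using conv_add_left[OF fb[OF z] fb[OF q]] by simp
    then show "conv G z z x = z x" by (simp add: ez qz)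
  qed
  have zs: "invol G z = z"
  proof -
    have ii: "invol G (invol G k) = k" for k by (simp add: invol_def fun_eq_iff)
    have "invol G q = q"
      unfolding q_def fun_eq_iff
      using invol_conv[of f "invol G f"] invol_conv[of g "invol G g"]
      by (simp add: ii) (simp add: invol_def fun_eq_iff)
    then show ?thesis using e_star by (simp add: z_def invol_def fun_eq_iff)
  qed
  have "reg_rep G e = cadd ?B (reg_rep G q) (cmult ?B (cstar ?B (reg_rep G z)) (reg_rep G z))"
    by (simp add: reg_rep_star reg_rep_mult reg_rep_plus z q zs zz) (simp add: z_def)
  then have le: "cstar_le ?B (reg_rep G q) (reg_rep G e)"
    unfolding cstar_le_def using reg_rep_carrier[OF q] reg_rep_carrier[OF e] reg_rep_carrier[OF z] by blast
  then show "cstar_le ?B (reg_rep G (\<lambda>x. conv G f (invol G f) x + conv G g (invol G g) x)) (reg_rep G e)"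
    by (simp add: q_def[abs_def])
  have proj: "projection ?B (reg_rep G e)"
    by (simp add: projection_def reg_rep_carrier reg_rep_mult reg_rep_star e ee e_star)
  \<comment> \<open>\<open>e\<close> fixes the point mass at any unit in \<open>A\<close>\<close>
  have "reg_rep G e \<noteq> czero ?B"
  proof
    assume a: "reg_rep G e = czero ?B"
    obtain u where u: "u \<in> A" using A(2) by blast
    have "reg_rep G e (indicator {u}) u = 0" unfolding a by (simp add: reduced_Cstar_def)
    then show False
      using u unit_simps(1)[of u] A(1)
      by (auto simp: reg_rep_def indicator_singleton_ell2 e_def conv_indicator_left[OF A(1)])
  qed
  then show "properly_infinite ?B (reg_rep G e)"
    unfolding properly_infinite_def partial_isometry_def
    using proj le
    by (intro conjI exI[of _ "reg_rep G f"] exI[of _ "reg_rep G g"])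
      (simp_all add: reg_rep_carrier reg_rep_star reg_rep_mult reg_rep_plus f g fs gs ff gg cff cgg
        q_def[abs_def])
qed

end

theorem proposition4p10:
  fixes G :: "'g::t2_space groupoid" and A :: "'g set"
  assumes "etale_groupoid G"
    and "A \<subseteq> units G" and "compact A" and "openin (top_of_set (units G)) A"
    and "paradoxical G (open_bisections G) 2 1 A"
  shows "(\<exists>f\<in>Cc. \<exists>g\<in>Cc.
            (\<forall>u\<in>units G. cond_exp G (reg_rep G f) u \<in> \<real>\<^sub>\<ge>\<^sub>0) \<and>
            (\<forall>u\<in>units G. cond_exp G (reg_rep G g) u \<in> \<real>\<^sub>\<ge>\<^sub>0) \<and>
            conv G (invol G f) f = indicator A \<and>
            conv G (invol G g) g = indicator A \<and>
            cstar_le (reduced_Cstar G)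
              (reg_rep G (\<lambda>x. conv G f (invol G f) x + conv G g (invol G g) x))
              (reg_rep G (indicator A))) \<and>
         properly_infinite (reduced_Cstar G) (reg_rep G (indicator A))"
proof -
  interpret etale G by unfold_locales (rule assms(1))
  have "open A" using assms(4) open_units by (metis openin_open_eq)
  then have e: "(indicator A :: 'g \<Rightarrow> complex) \<in> Cc" using assms(3) by (intro indicator_Cc)
  obtain n V m where ne: "A \<noteq> {}"
    and Vm: "\<forall>i\<in>{1..2::nat}. \<forall>j\<in>{1..n i::nat}. V i j \<in> open_bisections G \<and> m i j \<in> {1..1::nat}"
    and dV: "\<forall>i\<in>{1..2}. (\<Union>j\<in>{1..n i}. gdom G ` V i j) = A"
    and rV: "\<forall>i\<in>{1..2}. \<forall>j\<in>{1..n i}. (grng G ` V i j) \<times> {m i j} \<subseteq> A \<times> {1..1}"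
    and dis: "disjoint_family_on (\<lambda>(i, j). (grng G ` V i j) \<times> {m i j}) (SIGMA i:{1..2}. {1..n i})"
    using assms(5) unfolding paradoxical_def by blast
  have disj: "i = i' \<and> j = j'"
    if "i \<in> {1..2}" "j \<in> {1..n i}" "x \<in> V i j" "i' \<in> {1..2}" "j' \<in> {1..n i'}" "y \<in> V i' j'"
      "rng x = rng y" for i j i' j' x y
  proof (rule ccontr)
    assume "\<not> (i = i' \<and> j = j')"
    then have "(rng ` V i j) \<times> {m i j} \<inter> (rng ` V i' j') \<times> {m i' j'} = {}"
      using disjoint_family_onD[OF dis, of "(i, j)" "(i', j')"] that by auto
    \<comment> \<open>with a single level, disjointness of the products is disjointness of the ranges\<close>
    moreover have "m i j = m i' j'" using Vm that by force
    ultimately show False using that by blast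
  qed
  have "\<exists>f\<in>Cc. (\<forall>x. f x \<in> \<real>\<^sub>\<ge>\<^sub>0) \<and> (\<forall>x. f x \<noteq> 0 \<longrightarrow> (\<exists>j\<in>{1..n i}. x \<in> V i j)) \<and>
      conv G (invol G f) f = indicator A" if i: "i \<in> {1..2}" for i
  proof (rule section_of_bisections[of "{1..n i}" "V i" A])
    show "j = j'" if "j \<in> {1..n i}" "j' \<in> {1..n i}" "x \<in> V i j" "y \<in> V i j'" "rng x = rng y" for j j' x y
      using disj[OF i _ _ i] that by blast
  qed (use Vm dV i assms(3) in auto)
  from this[of 1] this[of 2] obtain f g where f: "f \<in> Cc" "\<And>x. f x \<in> \<real>\<^sub>\<ge>\<^sub>0"
      "\<And>x. f x \<noteq> 0 \<Longrightarrow> \<exists>j\<in>{1..n 1}. x \<in> V 1 j" "conv G (invol G f) f = indicator A"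
    and g: "g \<in> Cc" "\<And>x. g x \<in> \<real>\<^sub>\<ge>\<^sub>0"
      "\<And>x. g x \<noteq> 0 \<Longrightarrow> \<exists>j\<in>{1..n 2}. x \<in> V 2 j" "conv G (invol G g) g = indicator A"
    by auto
  have fg: "rng x \<noteq> rng y" if "f x \<noteq> 0" "g y \<noteq> 0" for x y
  proof
    assume r: "rng x = rng y"
    obtain j j' where "j \<in> {1..n 1}" "x \<in> V 1 j" "j' \<in> {1..n 2}" "y \<in> V 2 j'"
      using f(3) g(3) \<open>f x \<noteq> 0\<close> \<open>g y \<noteq> 0\<close> by blast
    then have "(1::nat) = 2 \<and> j = j'" using r by (intro disj[of 1 j x 2 j' y]) simp_all
    then show False by simp
  qed
  have A_V: "rng x \<in> A \<and> dom x \<in> A" if "i \<in> {1..2}" "j \<in> {1..n i}" "x \<in> V i j" for i j x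
    using rV dV that by blast
  have rf: "rng x \<in> A \<and> dom x \<in> A" if "f x \<noteq> 0" for x
    using f(3)[OF that] A_V[of 1] by auto
  have rg: "rng x \<in> A \<and> dom x \<in> A" if "g x \<noteq> 0" for x
    using g(3)[OF that] A_V[of 2] by auto
  note isometries = orthogonal_isometries_properly_infinite[OF assms(2) ne e f(1) g(1) f(4) g(4)
      conv_invol_eq_zero[OF fg] conv_invol_eq_zero[OF fg[symmetric]] rf rg]
  have E: "cond_exp G (reg_rep G k) u \<in> \<real>\<^sub>\<ge>\<^sub>0" if "u \<in> units G" "\<And>x. k x \<in> \<real>\<^sub>\<ge>\<^sub>0" for k u
    using cond_exp_reg_rep[OF algebraic that(1)] that(2) by simp
  show ?thesis
    by (intro conjI bexI[OF _ f(1)] bexI[OF _ g(1)] ballI E f(2,4) g(2,4) isometries)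
qed

end
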